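(* Let $(A,\widetilde{A})$ be a dual pair (i.e. $A,\widetilde{A}$ densely defined, closable, $A\subset\widetilde{A}^*$) of closed operators that has the common core property (there is $\mathcal{D}\subset\mathcal{D}(A)\cap\mathcal{D}(\widetilde{A})$ which is a core for both $A$ and $\widetilde{A}$), where $A$ is dissipative. Let $V:=\frac{A-\widetilde{A}}{2i}\upharpoonright_{\mathcal{D}}$ be the non-negative symmetric "imaginary part", and let $V_F$, $V_K$ denote its Friedrichs and Krein--von Neumann extensions. Let $\mathcal{V}\subset\mathcal{D}(\widetilde{A}^* )$ be a linear space with $\mathcal{V}\cap\mathcal{D}(A)=\{0\}$, let $\mathcal{L}:\mathcal{V}\to\mathcal{H}$ be linear, and define $A_{\mathcal{V},\mathcal{L}}$ on $\mathcal{D}(A)\dot{+}\mathcal{V}$ by $A_{\mathcal{V},\mathcal{L}}(f+v)=\widetilde{A}^*(f+v)+\mathcal{L}v$. Assume that $$v\in\mathcal{D}(V_K^{1/2})\qquad\text{and}\qquad \mathcal{L}v\in\operatorname{ran}(V_F^{1/2})=\mathcal{D}(V_F^{-1/2})$$ for all $v\in\mathcal{V}$. Then $A_{\mathcal{V},\mathcal{L}}$ is dissipative if and only if for all $v\in\mathcal{V}$, $$\operatorname{Im}\langle v,(\widetilde{A}^*+\mathcal{L})v\rangle\geq\frac{1}{4}\|\mathcal{U}V_F^{-1/2}\mathcal{L}v+2iV_K^{1/2}v\|^2.$$ Here $V_F^{-1/2}$ is the inverse of $V_F^{1/2}$ as an operator in $\overline{\operatorname{ran}(V_F^{1/2})}$,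 i.e. $V_F^{-1/2}:\operatorname{ran}V_F^{1/2}\to\mathcal{D}(V_F^{1/2})\cap\overline{\operatorname{ran}(V_F^{1/2})}$, $V_F^{1/2}f\mapsto f$, a well-defined non-negative selfadjoint operator on $\overline{\operatorname{ran}(V_F^{1/2})}$; and $\mathcal{U}$ is the partial isometry on $\mathcal{H}$ with $V_K^{1/2}h=\mathcal{U}V_F^{1/2}h$ for all $h\in\mathcal{D}(V_F^{1/2})$, isometric on $\overline{\operatorname{ran}(V_F^{1/2})}$, zero on $\ker V_F^{1/2}$, and with range contained in $\overline{\operatorname{ran}(V_K^{1/2})}$.
   Context: Dissipative means $\operatorname{Im}\langle\psi,A\psi\rangle\geq 0$ for all $\psi$ in the domain; the inner product is antilinear in the first argument. *)

theory Defs
  imports "HOL-Analysis.Analysis"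
begin

text \<open>HOL-Analysis only provides real inner product spaces.  A complex inner
product space is a real inner product space with a complex scalar multiplication
extending the real one and a sesquilinear form (antilinear in the FIRST argument)
whose real part is the real inner product (so norm x = sqrt (Re (cinner x x))).\<close>

class complex_inner = real_inner +
  fixes scaleC :: "complex \<Rightarrow> 'a \<Rightarrow> 'a"  (infixr \<open>*\<^sub>C\<close> 75)
    and cinner :: "'a \<Rightarrow> 'a \<Rightarrow> complex"
  assumes scaleC_add_right: "a *\<^sub>C (x + y) = a *\<^sub>C x + a *\<^sub>C y"
    and scaleC_add_left: "(a + b) *\<^sub>C x = a *\<^sub>C x + b *\<^sub>C x"
    and scaleC_scaleC: "a *\<^sub>C (b *\<^sub>C x) = (a * b) *\<^sub>C x"
    and scaleC_one: "1 *\<^sub>C x = x"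
    and scaleR_scaleC: "r *\<^sub>R x = complex_of_real r *\<^sub>C x"
    and cinner_commute: "cinner x y = cnj (cinner y x)"
    and cinner_add_right: "cinner x (y + z) = cinner x y + cinner x z"
    and cinner_scaleC_right: "cinner x (a *\<^sub>C y) = a * cinner x y"
    and Re_cinner: "Re (cinner x y) = inner x y"

class chilbert_space = complex_inner + complete_space


instantiation complex :: complex_inner
begin
definition scaleC_complex :: "complex \<Rightarrow> complex \<Rightarrow> complex" where "scaleC_complex a x = a * x"
definition cinner_complex :: "complex \<Rightarrow> complex \<Rightarrow> complex" where "cinner_complex x y = cnj x * y"
instance by standard (auto simp: scaleC_complex_def cinner_complex_def inner_complex_def
  algebra_simps scaleR_conv_of_real)
end

instance complex :: chilbert_space ..

text \<open>An operator in H is represented by its graph, a set of pairs (x, T x).\<close>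
type_synonym 'a op = "('a \<times> 'a) set"

definition csubspace :: "'a::complex_inner set \<Rightarrow> bool" where
  "csubspace S \<longleftrightarrow> 0 \<in> S \<and> (\<forall>x\<in>S. \<forall>y\<in>S. x + y \<in> S) \<and> (\<forall>c. \<forall>x\<in>S. c *\<^sub>C x \<in> S)"

definition is_operator :: "'a::complex_inner op \<Rightarrow> bool" where
  "is_operator G \<longleftrightarrow> (0, 0) \<in> G
     \<and> (\<forall>x y x' y'. (x, y) \<in> G \<longrightarrow> (x', y') \<in> G \<longrightarrow> (x + x', y + y') \<in> G)
     \<and> (\<forall>c x y. (x, y) \<in> G \<longrightarrow> (c *\<^sub>C x, c *\<^sub>C y) \<in> G)
     \<and> (\<forall>y. (0, y) \<in> G \<longrightarrow> y = 0)"

definition dom_op :: "'a op \<Rightarrow> 'a set" where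
  "dom_op G = fst ` G"

definition ran_op :: "'a op \<Rightarrow> 'a set" where
  "ran_op G = snd ` G"

definition ker_op :: "'a::zero op \<Rightarrow> 'a set" where
  "ker_op G = {x. (x, 0) \<in> G}"

text \<open>Value of the operator at x (meaningful for x in the domain).\<close>
definition app :: "'a op \<Rightarrow> 'a \<Rightarrow> 'a" where
  "app G x = (THE y. (x, y) \<in> G)"

definition densely_defined :: "'a::complex_inner op \<Rightarrow> bool" where
  "densely_defined G \<longleftrightarrow> is_operator G \<and> closure (dom_op G) = UNIV"

definition closed_op :: "'a::complex_inner op \<Rightarrow> bool" where
  "closed_op G \<longleftrightarrow> is_operator G \<and> closed G"

definition closable :: "'a::complex_inner op \<Rightarrow> bool" where
  "closable G \<longleftrightarrow> is_operator G \<and> is_operator (closure G)"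

definition adjoint :: "'a::complex_inner op \<Rightarrow> 'a op" where
  "adjoint G = {(y, z). \<forall>(x, w)\<in>G. cinner w y = cinner x z}"

definition restrict_op :: "'a op \<Rightarrow> 'a set \<Rightarrow> 'a op" where
  "restrict_op G D = {(x, y) \<in> G. x \<in> D}"

definition is_core :: "'a::complex_inner set \<Rightarrow> 'a op \<Rightarrow> bool" where
  "is_core D G \<longleftrightarrow> csubspace D \<and> D \<subseteq> dom_op G \<and> closure (restrict_op G D) = closure G"

definition dual_pair :: "'a::complex_inner op \<Rightarrow> 'a op \<Rightarrow> bool" where
  "dual_pair A A' \<longleftrightarrow> densely_defined A \<and> densely_defined A' \<and> closable A \<and> closable A'
     \<and> A \<subseteq> adjoint A'"

definition common_core_property :: "'a::complex_inner op \<Rightarrow> 'a op \<Rightarrow> bool" where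
  "common_core_property A A' \<longleftrightarrow> (\<exists>D. D \<subseteq> dom_op A \<inter> dom_op A' \<and> is_core D A \<and> is_core D A')"

definition dissipative :: "'a::complex_inner op \<Rightarrow> bool" where
  "dissipative G \<longleftrightarrow> (\<forall>(x, y)\<in>G. 0 \<le> Im (cinner x y))"

definition nonneg_op :: "'a::complex_inner op \<Rightarrow> bool" where
  "nonneg_op G \<longleftrightarrow> (\<forall>(x, y)\<in>G. Im (cinner x y) = 0 \<and> 0 \<le> Re (cinner x y))"

definition selfadjoint :: "'a::complex_inner op \<Rightarrow> bool" where
  "selfadjoint G \<longleftrightarrow> densely_defined G \<and> adjoint G = G"

definition nonneg_selfadjoint :: "'a::complex_inner op \<Rightarrow> bool" where
  "nonneg_selfadjoint G \<longleftrightarrow> selfadjoint G \<and> nonneg_op G"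

definition comp_op :: "'a op \<Rightarrow> 'a op \<Rightarrow> 'a op" where
  "comp_op G H = {(x, z). \<exists>y. (x, y) \<in> H \<and> (y, z) \<in> G}"

definition op_sqrt :: "'a::complex_inner op \<Rightarrow> 'a op" where
  "op_sqrt T = (THE S. nonneg_selfadjoint S \<and> comp_op S S = T)"

definition form_le :: "'a::complex_inner op \<Rightarrow> 'a op \<Rightarrow> bool" where
  "form_le S T \<longleftrightarrow> dom_op (op_sqrt T) \<subseteq> dom_op (op_sqrt S)
     \<and> (\<forall>f\<in>dom_op (op_sqrt T). norm (app (op_sqrt S) f) \<le> norm (app (op_sqrt T) f))"

text \<open>Friedrichs extension of a densely defined non-negative symmetric V:
  restriction of V* to the domain of the closure of the form t[f] = <f, V f>.\<close>
definition form_closure_dom :: "'a::complex_inner op \<Rightarrow> 'a set" where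
  "form_closure_dom V = {f. \<exists>u. (\<forall>n. u n \<in> dom_op V) \<and> u \<longlonglongrightarrow> f
     \<and> (\<forall>e>0. \<exists>N. \<forall>m\<ge>N. \<forall>n\<ge>N. Re (cinner (u m - u n) (app V (u m - u n))) < e)}"

definition friedrichs :: "'a::complex_inner op \<Rightarrow> 'a op" where
  "friedrichs V = {(f, g) \<in> adjoint V. f \<in> form_closure_dom V}"

definition krein :: "'a::complex_inner op \<Rightarrow> 'a op" where
  "krein V = (THE K. nonneg_selfadjoint K \<and> V \<subseteq> K
     \<and> (\<forall>T. nonneg_selfadjoint T \<and> V \<subseteq> T \<longrightarrow> form_le K T))"

definition inv_sqrt :: "'a::complex_inner op \<Rightarrow> 'a op" where
  "inv_sqrt T = {(app (op_sqrt T) f, f) | f.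
      f \<in> dom_op (op_sqrt T) \<and> f \<in> closure (ran_op (op_sqrt T))}"

definition clinear_fun :: "('a::complex_inner \<Rightarrow> 'a) \<Rightarrow> bool" where
  "clinear_fun U \<longleftrightarrow> (\<forall>x y. U (x + y) = U x + U y) \<and> (\<forall>c x. U (c *\<^sub>C x) = c *\<^sub>C U x)"

definition part_iso :: "'a::complex_inner op \<Rightarrow> 'a op \<Rightarrow> ('a \<Rightarrow> 'a)" where
  "part_iso VF VK = (THE U. clinear_fun U
     \<and> (\<forall>h\<in>dom_op (op_sqrt VF). app (op_sqrt VK) h = U (app (op_sqrt VF) h))
     \<and> (\<forall>x\<in>closure (ran_op (op_sqrt VF)). norm (U x) = norm x)
     \<and> (\<forall>x\<in>ker_op (op_sqrt VF). U x = 0)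
     \<and> range U \<subseteq> closure (ran_op (op_sqrt VK)))"

definition imag_part :: "'a::complex_inner op \<Rightarrow> 'a op \<Rightarrow> 'a set \<Rightarrow> 'a op" where
  "imag_part A A' D = {(f, (1 / (2 * \<i>)) *\<^sub>C (app A f - app A' f)) | f. f \<in> D}"

definition ext_op :: "'a::complex_inner op \<Rightarrow> 'a op \<Rightarrow> 'a set \<Rightarrow> ('a \<Rightarrow> 'a) \<Rightarrow> 'a op" where
  "ext_op A A' W L = {(f + v, app (adjoint A') (f + v) + L v) | f v. f \<in> dom_op A \<and> v \<in> W}"

end

theory Submission
  imports Defs
begin

text \<open>For \<open>f\<close> in the core and \<open>v \<in> \<V>\<close>, the dual pair relation and the factorisations
  \<open>V f = V\<^sub>K\<^sup>1\<^sup>/\<^sup>2 V\<^sub>K\<^sup>1\<^sup>/\<^sup>2 f\<close> and \<open>\<L> v = V\<^sub>F\<^sup>1\<^sup>/\<^sup>2 V\<^sub>F\<^sup>-\<^sup>1\<^sup>/\<^sup>2 \<L> v\<close> turn the imaginary part of the form at \<open>f + v\<close> into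
  \<open>\<parallel>\<xi> - (i/2) \<eta>\<parallel>\<^sup>2 + Im \<langle>v, (At\<^sup>* + \<L>) v\<rangle> - \<parallel>\<eta>\<parallel>\<^sup>2 / 4\<close>, where \<open>\<xi> = V\<^sub>K\<^sup>1\<^sup>/\<^sup>2 f\<close> and
  \<open>\<eta> = \<U> V\<^sub>F\<^sup>-\<^sup>1\<^sup>/\<^sup>2 \<L> v + 2 i V\<^sub>K\<^sup>1\<^sup>/\<^sup>2 v\<close>. One direction is then immediate; the other holds because
  the vectors \<open>V\<^sub>K\<^sup>1\<^sup>/\<^sup>2 f\<close> with \<open>f\<close> in the core are dense in the closure of the range of \<open>V\<^sub>K\<^sup>1\<^sup>/\<^sup>2\<close>.

  The Friedrichs extension exists for every nonnegative symmetric linear relation, by minimising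
  the form; the Krein extension is the inverse of the Friedrichs extension of the relation
  \<open>V\<^sup>-\<^sup>1\<close>. Both are graphs \<open>{(C\<^sup>2 x, E\<^sup>2 x)}\<close> with bounded commuting \<open>C, E \<ge> 0\<close>, \<open>C\<^sup>2 + E\<^sup>2 = 1\<close>, whose
  square roots are \<open>{(C x, E x)}\<close>, so everything reduces to square roots of bounded operators.
  Only the real inner product matters up to that point: complex linearity amounts to invariance
  of the graphs under multiplication by \<open>i\<close>.\<close>

section \<open>Bounded positive operators\<close>

instance chilbert_space \<subseteq> banach ..

text \<open>The functional \<open>J x = a x x - 2 * \<phi> x\<close> is bounded below on
  \<open>X\<close>. The parallelogram law makes near-minimisers Cauchy for \<open>a\<close>, and
  varying them along \<open>y\<close> gives the limit of \<open>a (u n) y\<close>. Since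
  \<open>a\<close> may be degenerate and \<open>X\<close> incomplete, a sequence takes the place of
  the Riesz vector and each application forms its own limit.\<close>

lemma approx_riesz:
  fixes a :: "'v::real_vector \<Rightarrow> 'v \<Rightarrow> real"
  assumes X: "subspace X" and bil: "bilinear a"
    and sym: "\<And>x y. x \<in> X \<Longrightarrow> y \<in> X \<Longrightarrow> a x y = a y x"
    and pos: "\<And>x. x \<in> X \<Longrightarrow> 0 \<le> a x x"
    and lin: "linear \<phi>" and K: "0 \<le> K"
    and bd: "\<And>x. x \<in> X \<Longrightarrow> (\<phi> x)\<^sup>2 \<le> K * a x x"
  obtains u :: "nat \<Rightarrow> 'v" where "\<And>n. u n \<in> X"
    "\<And>m n. a (u m - u n) (u m - u n) \<le> 2 / real (Suc m) + 2 / real (Suc n)"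
    "\<And>y. y \<in> X \<Longrightarrow> (\<lambda>n. a (u n) y) \<longlonglongrightarrow> \<phi> y"
proof -
  note al = bilinear_ladd[OF bil] bilinear_radd[OF bil] bilinear_lmul[OF bil] bilinear_rmul[OF bil]
     bilinear_lsub[OF bil] bilinear_rsub[OF bil]
  note pl = linear_add[OF lin] linear_diff[OF lin] linear_cmul[OF lin]
  define J where "J x = a x x - 2 * \<phi> x" for x
  have Jlow: "- K \<le> J x" if "x \<in> X" for x
  proof -
    have "(2 * \<phi> x)\<^sup>2 \<le> (a x x + K)\<^sup>2"
      using bd[OF that] sum_squares_bound[of "a x x" K] by (simp add: power2_eq_square algebra_simps)
    then have "\<bar>2 * \<phi> x\<bar> \<le> \<bar>a x x + K\<bar>" by (simp add: abs_le_square_iff)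
    then show ?thesis using pos[OF that] K by (simp add: J_def)
  qed
  define m where "m = Inf (J ` X)"
  have bb: "bdd_below (J ` X)" using Jlow by (meson bdd_belowI2)
  have mle: "m \<le> J x" if "x \<in> X" for x
    unfolding m_def using that bb by (simp add: cINF_lower)
  have "\<exists>x\<in>X. J x < m + 1 / real (Suc n)" for n
  proof -
    have "J ` X \<noteq> {}" using subspace_0[OF X] by auto
    then have "\<exists>y\<in>J ` X. y < m + 1 / real (Suc n)"
      unfolding m_def using cInf_lessD[of "J ` X" "Inf (J ` X) + 1 / real (Suc n)"] by force
    then show ?thesis by auto
  qed
  then obtain u where uX: "\<And>n. u n \<in> X" and Ju: "\<And>n. J (u n) < m + 1 / real (Suc n)" by metis
  show thesis
  proof (rule that[OF uX])
    fix k n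
    let ?x = "u k" let ?y = "u n"
    let ?z = "(1/2) *\<^sub>R (?x + ?y)"
    \<comment> \<open>The midpoint is an admissible competitor: \<open>J\<close> there is the
      average of the two values minus a quarter of \<open>a\<close> at the difference, so the two
      excesses over \<open>m\<close> control the difference.\<close>
    have "?z \<in> X" using X uX by (simp add: subspace_add subspace_mul)
    then have "m \<le> J ?z" by (rule mle)
    moreover have "J ?z = (J ?x + J ?y) / 2 - a (?x - ?y) (?x - ?y) / 4"
      using sym[OF uX uX, of k n] by (simp add: J_def al pl field_simps)
    moreover have "a \<le> 2 * e + 2 * e'"
      if "m \<le> z" "z = (s + t) / 2 - a / 4" "s < m + e" "t < m + e'" for a e e' s t z :: real
      using that by (simp add: field_simps)
    ultimately have "a (?x - ?y) (?x - ?y) \<le> 2 * (1 / real (Suc k)) + 2 * (1 / real (Suc n))"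
      using Ju[of k] Ju[of n] by blast
    then show "a (?x - ?y) (?x - ?y) \<le> 2 / real (Suc k) + 2 / real (Suc n)" by simp
  next
    fix y assume y: "y \<in> X"
    define d where "d n = a (u n) y - \<phi> y" for n
    let ?q = "a y y"
    have q: "0 \<le> ?q" by (rule pos[OF y])
    have dn: "(d n)\<^sup>2 \<le> (?q + 1) * (1 / real (Suc n))" for n
    proof -
      \<comment> \<open>This \<open>t\<close> minimises
        \<open>2 * t * d n + t\<^sup>2 * (?q + 1)\<close>; the added 1 keeps the denominator
        positive when \<open>?q = 0\<close>.\<close>
      define t where "t = - d n / (?q + 1)"
      have "u n + t *\<^sub>R y \<in> X" using X uX y by (simp add: subspace_add subspace_mul)
      then have "m \<le> J (u n + t *\<^sub>R y)" by (rule mle)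
      also have "\<dots> = J (u n) + 2 * t * d n + t\<^sup>2 * ?q"
        using sym[OF uX y, of n] by (simp add: J_def d_def al pl power2_eq_square algebra_simps)
      finally have "- (2 * t * d n + t\<^sup>2 * ?q) \<le> 1 / real (Suc n)" using Ju[of n] by simp
      moreover have "(d n)\<^sup>2 / (?q + 1) \<le> - (2 * t * d n + t\<^sup>2 * ?q)"
      proof -
        have "t\<^sup>2 * ?q \<le> t\<^sup>2 * (?q + 1)" by (simp add: mult_left_mono)
        moreover have "t\<^sup>2 * (?q + 1) = (d n)\<^sup>2 / (?q + 1)" "2 * t * d n = - 2 * ((d n)\<^sup>2 / (?q + 1))"
          using q by (auto simp: t_def power2_eq_square)
        ultimately show ?thesis by simp
      qed
      ultimately have "(d n)\<^sup>2 / (?q + 1) \<le> 1 / real (Suc n)" by simp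
      then show ?thesis using q by (simp add: pos_divide_le_eq mult.commute)
    qed
    have "(\<lambda>n. (?q + 1) * (1 / real (Suc n))) \<longlonglongrightarrow> (?q + 1) * 0"
      by (intro tendsto_mult tendsto_const LIMSEQ_Suc[OF lim_1_over_n])
    then have "(\<lambda>n. (d n)\<^sup>2) \<longlonglongrightarrow> 0"
      using dn by (intro tendsto_sandwich[of "\<lambda>_. 0" "\<lambda>n. (d n)\<^sup>2"]) (auto intro!: always_eventually)
    then have "d \<longlonglongrightarrow> 0" by simp
    then show "(\<lambda>n. a (u n) y) \<longlonglongrightarrow> \<phi> y"
      unfolding d_def by (subst (asm) LIM_zero_iff)
  qed
qed

lemma reciprocal_bound_small:
  fixes b :: "nat \<Rightarrow> nat \<Rightarrow> real"
  assumes b: "\<And>m n. b m n \<le> 2 / real (Suc m) + 2 / real (Suc n)" and e: "0 < e"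
  shows "\<exists>N. \<forall>m\<ge>N. \<forall>n\<ge>N. b m n < e"
proof -
  obtain N where "4 / e < real N" using reals_Archimedean2 by blast
  moreover have "0 < 4 / e" using e by simp
  ultimately have "0 < real N" by linarith
  with \<open>4 / e < real N\<close> have N: "0 < real N" "4 / real N < e" using e by (auto simp: field_simps)
  have "b m n < e" if "m \<ge> N" "n \<ge> N" for m n
  proof -
    have "2 / real (Suc m) \<le> 2 / real N" "2 / real (Suc n) \<le> 2 / real N"
      using that N(1) by (auto intro!: divide_left_mono)
    then show ?thesis using b[of m n] N(2) by simp
  qed
  then show ?thesis by blast
qed

lemma CauchyI_power2:
  fixes r :: "nat \<Rightarrow> 'a::real_normed_vector"
  assumes small: "\<And>e. 0 < e \<Longrightarrow> \<exists>N. \<forall>m\<ge>N. \<forall>n\<ge>N. (norm (r m - r n))\<^sup>2 < e"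
  shows "Cauchy r"
proof (rule CauchyI)
  fix e :: real assume e: "e > 0"
  then have "0 < e\<^sup>2" by simp
  from small[OF this] obtain N where "\<And>m n. m \<ge> N \<Longrightarrow> n \<ge> N \<Longrightarrow> (norm (r m - r n))\<^sup>2 < e\<^sup>2"
    by blast
  then have "norm (r m - r n) < e" if "m \<ge> N" "n \<ge> N" for m n
    using that e by (meson less_imp_le power2_less_imp_less)
  then show "\<exists>M. \<forall>m\<ge>M. \<forall>n\<ge>M. norm (r m - r n) < e" by blast
qed

text \<open>For a symmetric operator, \<open>B\<^sup>2 \<le> B\<close> is another way of saying that
  \<open>B\<close> lies between 0 and 1; in this form the bound \<open>norm B \<le> 1\<close> is
  immediate.\<close>

definition unit_bl :: "('a::real_inner \<Rightarrow>\<^sub>L 'a) \<Rightarrow> bool" where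
  "unit_bl B \<longleftrightarrow> (\<forall>x y. B x \<bullet> y = x \<bullet> B y) \<and> (\<forall>x. B x \<bullet> B x \<le> B x \<bullet> x)"

definition pos_bl :: "('a::real_inner \<Rightarrow>\<^sub>L 'a) \<Rightarrow> bool" where
  "pos_bl B \<longleftrightarrow> (\<forall>x y. B x \<bullet> y = x \<bullet> B y) \<and> (\<forall>x. 0 \<le> B x \<bullet> x)"

lemma pos_bl_sym: "pos_bl B \<Longrightarrow> B x \<bullet> y = x \<bullet> B y"
  and pos_bl_nonneg: "pos_bl B \<Longrightarrow> 0 \<le> B x \<bullet> x"
  by (auto simp: pos_bl_def)

text \<open>The defect is symmetric in the two operators:
  \<open>(1 - B) - (1 - B)\<^sup>2 = B - B\<^sup>2\<close>.\<close>

lemma unit_bl_complement: "unit_bl B \<Longrightarrow> unit_bl (id_blinfun - B)"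
  by (simp add: unit_bl_def blinfun.diff_left inner_diff_left inner_diff_right)
     metis

lemma unit_bl_norm: assumes "unit_bl B" shows "norm B \<le> 1"
proof (rule norm_blinfun_bound)
  fix x
  have "(norm (B x))\<^sup>2 \<le> B x \<bullet> x" using assms unfolding unit_bl_def power2_norm_eq_inner by blast
  also have "\<dots> \<le> norm (B x) * norm x" by (rule norm_cauchy_schwarz)
  finally show "norm (B x) \<le> 1 * norm x"
    by (cases "norm (B x) = 0") (auto simp: power2_eq_square)
qed simp

text \<open>With \<open>X = 1 - B\<close>, the square root of \<open>B\<close> is \<open>1 - Z\<close> for the fixed point \<open>Z = (X + Z\<^sup>2) / 2\<close>;
  the scalar iteration for \<open>X = 1\<close> majorises the operator iteration.\<close>

lemma unit_bl_sqrt: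
  fixes B :: "'a::{real_inner,banach} \<Rightarrow>\<^sub>L 'a"
  assumes B: "unit_bl B"
  obtains C where "pos_bl C" "C o\<^sub>L C = B"
    "\<And>J. J o\<^sub>L B = B o\<^sub>L J \<Longrightarrow> J o\<^sub>L C = C o\<^sub>L J"
proof -
  note bb = bounded_bilinear_blinfun_compose
  note cl = bounded_bilinear.add_left[OF bb] bounded_bilinear.add_right[OF bb]
    bounded_bilinear.diff_left[OF bb] bounded_bilinear.diff_right[OF bb]
    bounded_bilinear.scaleR_left[OF bb] bounded_bilinear.scaleR_right[OF bb]
    bounded_bilinear.zero_left[OF bb] bounded_bilinear.zero_right[OF bb]
  have assoc: "(P o\<^sub>L Q) o\<^sub>L R = P o\<^sub>L (Q o\<^sub>L R)" for P Q R :: "'a \<Rightarrow>\<^sub>L 'a"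
    by (rule blinfun_eqI) simp
  have cid: "P o\<^sub>L id_blinfun = P" "id_blinfun o\<^sub>L P = P" for P :: "'a \<Rightarrow>\<^sub>L 'a"
    by (auto intro!: blinfun_eqI)
  define X where "X = id_blinfun - B"
  have uX: "unit_bl X" unfolding X_def by (rule unit_bl_complement[OF B])
  have nX: "norm X \<le> 1" by (rule unit_bl_norm[OF uX])
  have symX: "X x \<bullet> y = x \<bullet> X y" for x y using uX by (simp add: unit_bl_def)
  define Y where "Y = rec_nat 0 (\<lambda>_ Z. (1/2) *\<^sub>R (X + (Z o\<^sub>L Z)))"
  define y where "y = rec_nat 0 (\<lambda>_ z. (1/2) * (1 + z * z :: real))"
  have Y0: "Y 0 = 0" and YS: "\<And>n. Y (Suc n) = (1/2) *\<^sub>R (X + (Y n o\<^sub>L Y n))" by (auto simp: Y_def)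
  have y0: "y 0 = 0" and yS: "\<And>n. y (Suc n) = (1/2) * (1 + y n * y n)" by (auto simp: y_def)
  have y01: "0 \<le> y n \<and> y n \<le> 1" for n
    by (induction n) (auto simp: y0 yS mult_le_one)
  have comm: "J o\<^sub>L Y n = Y n o\<^sub>L J" if "J o\<^sub>L X = X o\<^sub>L J" for J n
  proof (induction n)
    case (Suc n)
    have "J o\<^sub>L (Y n o\<^sub>L Y n) = (Y n o\<^sub>L Y n) o\<^sub>L J" by (metis Suc assoc)
    then show ?case by (simp add: YS cl that)
  qed (simp add: Y0 cl)
  have YY: "Y m o\<^sub>L Y n = Y n o\<^sub>L Y m" for m n
    by (rule comm) (rule comm[symmetric], simp)
  have Yn: "norm (Y n) \<le> y n" for n
  proof (induction n)
    case (Suc n)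
    have "norm (Y n o\<^sub>L Y n) \<le> y n * y n"
      by (meson Suc norm_blinfun_compose order_trans mult_mono norm_ge_zero y01)
    then have "norm (X + (Y n o\<^sub>L Y n)) \<le> 1 + y n * y n" using nX norm_triangle_mono by blast
    then show ?case by (simp add: YS yS)
  qed (simp add: Y0 y0)
  \<comment> \<open>The iterates commute, so the difference of their squares factors as
    (difference)(sum), exactly as for the scalars; both factors are dominated by the scalar
    ones.\<close>
  have step: "norm (Y (Suc n) - Y n) \<le> y (Suc n) - y n" for n
  proof (induction n)
    case 0
    then show ?case using Yn[of "Suc 0"] by (simp add: Y0 y0)
  next
    case (Suc n)
    have "Y (Suc (Suc n)) - Y (Suc n) = (1/2) *\<^sub>R ((Y (Suc n) - Y n) o\<^sub>L (Y (Suc n) + Y n))"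
      unfolding YS[of "Suc n"] by (subst (3) YS)
        (simp add: cl YY[of n "Suc n"] scaleR_right_diff_distrib[symmetric] del: scaleR_right_diff_distrib)
    moreover have "norm ((Y (Suc n) - Y n) o\<^sub>L (Y (Suc n) + Y n)) \<le> (y (Suc n) - y n) * (y (Suc n) + y n)"
      by (rule order_trans[OF norm_blinfun_compose], rule mult_mono[OF Suc norm_triangle_mono[OF Yn Yn]])
         (use Suc norm_ge_zero order_trans in \<open>blast, simp\<close>)
    ultimately have "norm (Y (Suc (Suc n)) - Y (Suc n)) \<le> (1/2) * ((y (Suc n) - y n) * (y (Suc n) + y n))"
      by simp
    also have "\<dots> = y (Suc (Suc n)) - y (Suc n)"
      unfolding yS[of "Suc n"] using yS[of n] by (simp add: algebra_simps)
    finally show ?case .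
  qed
  have inc: "incseq y" by (rule incseq_SucI) (use order_trans[OF norm_ge_zero step] in simp)
  have "convergent y"
    using incseq_convergent[OF inc] y01 unfolding convergent_def by blast
  then have Cy: "Cauchy y" by (rule convergent_Cauchy)
  \<comment> \<open>Telescoping transfers the Cauchy property from the bounded monotone scalar
    sequence \<open>y\<close> to \<open>Y\<close>.\<close>
  have mn: "norm (Y (n + k) - Y n) \<le> y (n + k) - y n" for n k
  proof (induction k)
    case (Suc k)
    have "norm (Y (n + Suc k) - Y n) \<le> norm (Y (Suc (n + k)) - Y (n + k)) + norm (Y (n + k) - Y n)"
      using norm_triangle_ineq[of "Y (Suc (n + k)) - Y (n + k)" "Y (n + k) - Y n"] by simp
    then show ?case using Suc step[of "n + k"] by simp
  qed simp
  have "Cauchy Y"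
  proof (rule CauchyI')
    fix e :: real assume "0 < e"
    then obtain M where M: "\<And>m n. m \<ge> M \<Longrightarrow> n \<ge> M \<Longrightarrow> norm (y m - y n) < e"
      using CauchyD[OF Cy] by metis
    have "norm (Y m - Y n) < e" if "m \<ge> M" "n > m" for m n
    proof -
      have "norm (Y m - Y n) \<le> y n - y m" using mn[of m "n - m"] that by (simp add: norm_minus_commute)
      also have "\<dots> \<le> norm (y n - y m)" by simp
      also have "\<dots> < e" using M that by simp
      finally show ?thesis .
    qed
    then show "\<exists>M. \<forall>m\<ge>M. \<forall>n>m. dist (Y m) (Y n) < e" unfolding dist_norm by blast
  qed
  then obtain Z where Z: "Y \<longlonglongrightarrow> Z" using Cauchy_convergent convergent_def by blast
  have "(\<lambda>n. (1/2) *\<^sub>R (X + (Y n o\<^sub>L Y n))) \<longlonglongrightarrow> (1/2) *\<^sub>R (X + (Z o\<^sub>L Z))"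
    by (intro tendsto_intros bounded_bilinear.tendsto[OF bb] Z)
  moreover have "(\<lambda>n. (1/2) *\<^sub>R (X + (Y n o\<^sub>L Y n))) \<longlonglongrightarrow> Z"
    using LIMSEQ_Suc[OF Z] by (simp add: YS)
  ultimately have Zeq: "Z = (1/2) *\<^sub>R (X + (Z o\<^sub>L Z))" using LIMSEQ_unique by blast
  have "norm (Y n) \<le> 1" for n using Yn y01 order_trans by blast
  then have nZ: "norm Z \<le> 1"
    using Lim_bounded[OF tendsto_norm[OF Z], of 0 1] by blast
  have symY: "Y n x \<bullet> w = x \<bullet> Y n w" for n x w
    by (induction n arbitrary: x w)
       (simp_all add: Y0 YS blinfun.add_left blinfun.scaleR_left inner_add_left inner_add_right symX)
  have lim: "(\<lambda>n. Y n x) \<longlonglongrightarrow> Z x" for x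
    by (rule blinfun.tendsto[OF Z tendsto_const])
  have symZ: "Z x \<bullet> w = x \<bullet> Z w" for x w
  proof -
    have "(\<lambda>n. Y n x \<bullet> w) \<longlonglongrightarrow> Z x \<bullet> w" by (intro tendsto_inner lim tendsto_const)
    moreover have "(\<lambda>n. x \<bullet> Y n w) \<longlonglongrightarrow> x \<bullet> Z w" by (intro tendsto_inner lim tendsto_const)
    ultimately show ?thesis using LIMSEQ_unique by (simp add: symY)
  qed
  define C where "C = id_blinfun - Z"
  have "pos_bl C" unfolding pos_bl_def
  proof (intro conjI allI)
    fix x
    have "Z x \<bullet> x \<le> norm (Z x) * norm x" by (rule norm_cauchy_schwarz)
    also have "\<dots> \<le> norm x * norm x"
      by (rule mult_right_mono[OF order_trans[OF norm_blinfun]]) (use nZ in \<open>auto intro: mult_left_le_one_le\<close>)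
    finally show "0 \<le> C x \<bullet> x"
      by (simp add: C_def blinfun.diff_left inner_diff_left flip: power2_norm_eq_inner) (simp add: power2_eq_square)
  qed (simp add: C_def blinfun.diff_left inner_diff_left inner_diff_right symZ)
  moreover have "C o\<^sub>L C = B"
  proof -
    \<comment> \<open>The fixed point equation reads \<open>Z\<^sup>2 = 2 Z - X\<close>, hence
      \<open>(1 - Z)\<^sup>2 = 1 - X = B\<close>.\<close>
    have "X + (Z o\<^sub>L Z) = 2 *\<^sub>R Z" by (subst (2) Zeq) simp
    then have "Z o\<^sub>L Z = Z + Z - X" by (simp add: scaleR_2 algebra_simps)
    then show ?thesis by (simp add: C_def cl cid X_def)
  qed
  moreover have "J o\<^sub>L C = C o\<^sub>L J" if "J o\<^sub>L B = B o\<^sub>L J" for J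
  proof -
    \<comment> \<open>Whatever commutes with \<open>X\<close> commutes with every iterate, and the
      relation survives the norm limit.\<close>
    have "J o\<^sub>L X = X o\<^sub>L J" by (simp add: X_def cl cid that)
    then have "J o\<^sub>L Y n = Y n o\<^sub>L J" for n by (rule comm)
    moreover have "(\<lambda>n. J o\<^sub>L Y n) \<longlonglongrightarrow> (J o\<^sub>L Z)" "(\<lambda>n. Y n o\<^sub>L J) \<longlonglongrightarrow> (Z o\<^sub>L J)"
      by (rule bounded_bilinear.tendsto[OF bb]; rule tendsto_const Z)+
    ultimately have "J o\<^sub>L Z = Z o\<^sub>L J" using LIMSEQ_unique by simp
    then show ?thesis by (simp add: C_def cl cid)
  qed
  ultimately show thesis by (rule that)
qed

section \<open>Friedrichs extensions of linear relations\<close>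

text \<open>Nonnegativity of \<open>a\<close> at
  \<open>a y y *\<^sub>R x - a x y *\<^sub>R y\<close> gives the bound when
  \<open>a y y > 0\<close>, and symmetry covers \<open>a x x > 0\<close>; the remaining case has
  both diagonal values zero.\<close>

lemma psd_cauchy_schwarz:
  fixes a :: "'v::real_vector \<Rightarrow> 'v \<Rightarrow> real"
  assumes X: "subspace X" and bil: "bilinear a"
    and sym: "\<And>x y. x \<in> X \<Longrightarrow> y \<in> X \<Longrightarrow> a x y = a y x"
    and pos: "\<And>x. x \<in> X \<Longrightarrow> 0 \<le> a x x"
    and x: "x \<in> X" and y: "y \<in> X"
  shows "(a x y)\<^sup>2 \<le> a x x * a y y"
proof -
  note al = bilinear_ladd[OF bil] bilinear_radd[OF bil] bilinear_lmul[OF bil] bilinear_rmul[OF bil]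
     bilinear_lsub[OF bil] bilinear_rsub[OF bil]
  have *: "(a x y)\<^sup>2 \<le> a x x * a y y" if "x \<in> X" "y \<in> X" "a y y > 0" for x y
  proof -
    have "a y y *\<^sub>R x - a x y *\<^sub>R y \<in> X" using X that by (simp add: subspace_diff subspace_mul)
    then have "0 \<le> a (a y y *\<^sub>R x - a x y *\<^sub>R y) (a y y *\<^sub>R x - a x y *\<^sub>R y)" by (rule pos)
    also have "\<dots> = a y y * (a x x * a y y - (a x y)\<^sup>2)"
      using sym[of x y] that by (simp add: al power2_eq_square algebra_simps)
    finally show ?thesis using that by (simp add: zero_le_mult_iff)
  qed
  consider "a y y > 0" | "a x x > 0" | "a x x = 0" "a y y = 0"
    using pos[OF x] pos[OF y] by linarith
  then show ?thesis
  proof cases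
    case 1 then show ?thesis using * x y by blast
  next
    case 2 then show ?thesis using *[OF y x] sym[OF x y] by (simp add: mult.commute)
  next
    case 3
    \<comment> \<open>With both diagonal values zero, \<open>a\<close> at this vector is
      \<open>- 2 * (a x y)\<^sup>2\<close>, which forces \<open>a x y = 0\<close>.\<close>
    have "x - a x y *\<^sub>R y \<in> X" using X x y by (simp add: subspace_diff subspace_mul)
    then have "0 \<le> a (x - a x y *\<^sub>R y) (x - a x y *\<^sub>R y)" by (rule pos)
    then show ?thesis using sym[OF x y] 3 by (simp add: al power2_eq_square)
  qed
qed

text \<open>The adjoint relation for the real inner product. Relations may be multivalued, so that
  the inverse of an operator with a kernel is covered.\<close>

definition radj :: "('a::real_inner \<times> 'a) set \<Rightarrow> ('a \<times> 'a) set" where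
  "radj G = {(y, z). \<forall>(x, w)\<in>G. w \<bullet> y = x \<bullet> z}"

definition nonneg_sym :: "('a::real_inner \<times> 'a) set \<Rightarrow> bool" where
  "nonneg_sym V \<longleftrightarrow> subspace V \<and> V \<subseteq> radj V \<and> (\<forall>(x, y)\<in>V. 0 \<le> x \<bullet> y)"

definition nonneg_sa :: "('a::real_inner \<times> 'a) set \<Rightarrow> bool" where
  "nonneg_sa T \<longleftrightarrow> subspace T \<and> radj T = T \<and> (\<forall>(x, y)\<in>T. 0 \<le> x \<bullet> y)"

text \<open>The sequence lives in the graph: for a pair \<open>(f, g)\<close> the form value is
  \<open>f \<bullet> g\<close>, which makes sense without choosing a value of the relation at
  \<open>f\<close>.\<close>

definition form_Cauchy :: "(nat \<Rightarrow> 'a::real_inner \<times> 'a) \<Rightarrow> bool" where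
  "form_Cauchy p \<longleftrightarrow>
     (\<forall>e>0. \<exists>N. \<forall>m\<ge>N. \<forall>n\<ge>N. fst (p m - p n) \<bullet> snd (p m - p n) < e)"

definition fried :: "('a::real_inner \<times> 'a) set \<Rightarrow> ('a \<times> 'a) set" where
  "fried V = {(f, g) \<in> radj V.
     \<exists>p. (\<forall>n. p n \<in> V) \<and> (\<lambda>n. fst (p n)) \<longlonglongrightarrow> f \<and> form_Cauchy p}"

lemma radjI: "(\<And>x w. (x, w) \<in> G \<Longrightarrow> w \<bullet> y = x \<bullet> z) \<Longrightarrow> (y, z) \<in> radj G"
  by (auto simp: radj_def)

lemma radjD: "(y, z) \<in> radj G \<Longrightarrow> (x, w) \<in> G \<Longrightarrow> w \<bullet> y = x \<bullet> z"
  by (auto simp: radj_def)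

lemma radj_antimono: "G \<subseteq> H \<Longrightarrow> radj H \<subseteq> radj G"
  by (auto simp: radj_def)

lemma subspace_radj: "subspace (radj G)"
  by (auto simp: subspace_def radj_def inner_add_right zero_prod_def split_beta)

lemma nonneg_sa_imp_sym: "nonneg_sa T \<Longrightarrow> nonneg_sym T"
  by (auto simp: nonneg_sa_def nonneg_sym_def)

text \<open>On the product space the form is bilinear, so the graph itself can serve as the form
  domain in \<open>psd_cauchy_schwarz\<close>.\<close>

lemma bilinear_form: "bilinear (\<lambda>p q :: 'a::real_inner \<times> 'a. fst p \<bullet> snd q)"
  by (auto simp: bilinear_def inner_add_left inner_add_right intro!: linearI)

lemma friedE:
  assumes "(f, g) \<in> fried V"
  obtains p where "(f, g) \<in> radj V" "\<And>n. p n \<in> V" "(\<lambda>n. fst (p n)) \<longlonglongrightarrow> f" "form_Cauchy p"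
  using assms by (auto simp: fried_def)

lemma friedI:
  "v \<in> radj V \<Longrightarrow> (\<And>n. p n \<in> V) \<Longrightarrow> (\<lambda>n. fst (p n)) \<longlonglongrightarrow> fst v \<Longrightarrow> form_Cauchy p \<Longrightarrow> v \<in> fried V"
  by (cases v) (auto simp: fried_def)

section \<open>Calculus of the form of a nonnegative symmetric relation\<close>

context
  fixes V :: "('a::real_inner \<times> 'a) set"
  assumes V: "nonneg_sym V"
begin

lemma form_sym: "p \<in> V \<Longrightarrow> q \<in> V \<Longrightarrow> fst p \<bullet> snd q = fst q \<bullet> snd p"
  using V radjD[of "fst p" "snd p" V "fst q" "snd q"] unfolding nonneg_sym_def
  by (auto simp: inner_commute)

lemma form_pos: "p \<in> V \<Longrightarrow> 0 \<le> fst p \<bullet> snd p"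
  using V by (auto simp: nonneg_sym_def)

lemma form_subspace: "subspace V"
  using V by (simp add: nonneg_sym_def)

lemma form_cs: "p \<in> V \<Longrightarrow> q \<in> V \<Longrightarrow> (fst p \<bullet> snd q)\<^sup>2 \<le> (fst p \<bullet> snd p) * (fst q \<bullet> snd q)"
  using psd_cauchy_schwarz[OF form_subspace bilinear_form form_sym form_pos, of p q] .

lemma form_parallelogram:
  assumes "p \<in> V" "q \<in> V"
  shows "fst (p + q) \<bullet> snd (p + q) \<le> 2 * (fst p \<bullet> snd p) + 2 * (fst q \<bullet> snd q)"
  using form_pos[OF subspace_diff[OF form_subspace assms]]
  by (simp add: inner_add_left inner_add_right inner_diff_left inner_diff_right)

lemma form_Cauchy_bounded:
  assumes pV: "\<And>n. p n \<in> V" and p: "form_Cauchy p"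
  obtains M N where "0 < M" "\<And>n. n \<ge> N \<Longrightarrow> fst (p n) \<bullet> snd (p n) \<le> M"
proof -
  obtain N where N: "\<And>m n. m \<ge> N \<Longrightarrow> n \<ge> N \<Longrightarrow> fst (p m - p n) \<bullet> snd (p m - p n) < 1"
    using p zero_less_one unfolding form_Cauchy_def by blast
  show thesis
  proof (rule that[of "2 + 2 * (fst (p N) \<bullet> snd (p N))" N])
    show "0 < 2 + 2 * (fst (p N) \<bullet> snd (p N))" using form_pos[OF pV, of N] by simp
    fix n assume "n \<ge> N"
    then show "fst (p n) \<bullet> snd (p n) \<le> 2 + 2 * (fst (p N) \<bullet> snd (p N))"
      using form_parallelogram[OF subspace_diff[OF form_subspace pV pV] pV, of n N N] N[of n N] by simp
  qed
qed

lemma form_Cauchy_add: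
  assumes pV: "\<And>n. p n \<in> V" and p: "form_Cauchy p" and qV: "\<And>n. q n \<in> V" and q: "form_Cauchy q"
  shows "form_Cauchy (\<lambda>n. p n + q n)"
  unfolding form_Cauchy_def
proof (intro allI impI)
  fix e :: real assume "e > 0"
  then have e4: "e / 4 > 0" by simp
  obtain N1 where N1: "\<And>m n. m \<ge> N1 \<Longrightarrow> n \<ge> N1 \<Longrightarrow> fst (p m - p n) \<bullet> snd (p m - p n) < e / 4"
    using p e4 unfolding form_Cauchy_def by blast
  obtain N2 where N2: "\<And>m n. m \<ge> N2 \<Longrightarrow> n \<ge> N2 \<Longrightarrow> fst (q m - q n) \<bullet> snd (q m - q n) < e / 4"
    using q e4 unfolding form_Cauchy_def by blast
  have "fst (p m + q m - (p n + q n)) \<bullet> snd (p m + q m - (p n + q n)) < e"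
    if mn: "m \<ge> max N1 N2" "n \<ge> max N1 N2" for m n
  proof -
    have eq: "p m + q m - (p n + q n) = (p m - p n) + (q m - q n)" by simp
    have "fst (p m - p n) \<bullet> snd (p m - p n) < e / 4" by (rule N1) (use mn in auto)
    moreover have "fst (q m - q n) \<bullet> snd (q m - q n) < e / 4" by (rule N2) (use mn in auto)
    moreover note form_parallelogram[OF subspace_diff[OF form_subspace pV pV]
      subspace_diff[OF form_subspace qV qV], of m n m n]
    ultimately show ?thesis unfolding eq by linarith
  qed
  then show "\<exists>N. \<forall>m\<ge>N. \<forall>n\<ge>N. fst (p m + q m - (p n + q n)) \<bullet> snd (p m + q m - (p n + q n)) < e"
    by blast
qed

lemma form_Cauchy_scaleR:
  assumes p: "form_Cauchy p"
  shows "form_Cauchy (\<lambda>n. c *\<^sub>R p n)"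
  unfolding form_Cauchy_def
proof (intro allI impI)
  fix e :: real assume "e > 0"
  \<comment> \<open>Dividing by \<open>c\<^sup>2 + 1\<close> instead of \<open>c\<^sup>2\<close>
    also covers \<open>c = 0\<close>.\<close>
  then have "e / (c\<^sup>2 + 1) > 0" by (simp add: add_nonneg_pos)
  then obtain N where N: "\<And>m n. m \<ge> N \<Longrightarrow> n \<ge> N \<Longrightarrow>
      fst (p m - p n) \<bullet> snd (p m - p n) < e / (c\<^sup>2 + 1)"
    using p unfolding form_Cauchy_def by blast
  have "fst (c *\<^sub>R p m - c *\<^sub>R p n) \<bullet> snd (c *\<^sub>R p m - c *\<^sub>R p n) < e"
    if "m \<ge> N" "n \<ge> N" for m n
  proof -
    let ?r = "fst (p m - p n) \<bullet> snd (p m - p n)"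
    have "c *\<^sub>R p m - c *\<^sub>R p n = c *\<^sub>R (p m - p n)" by (simp add: scaleR_right_diff_distrib)
    then have "fst (c *\<^sub>R p m - c *\<^sub>R p n) \<bullet> snd (c *\<^sub>R p m - c *\<^sub>R p n) = c\<^sup>2 * ?r"
      by (simp add: power2_eq_square scaleR_right_diff_distrib[symmetric] del: scaleR_right_diff_distrib)
    also have "\<dots> \<le> c\<^sup>2 * (e / (c\<^sup>2 + 1))" using N[OF that] by (intro mult_left_mono) auto
    also have "\<dots> < e"
    proof -
      have "0 < c\<^sup>2 + 1" by (simp add: add_nonneg_pos)
      then show ?thesis using \<open>e > 0\<close> by (simp add: field_simps)
    qed
    finally show ?thesis .
  qed
  then show "\<exists>N. \<forall>m\<ge>N. \<forall>n\<ge>N. fst (c *\<^sub>R p m - c *\<^sub>R p n) \<bullet> snd (c *\<^sub>R p m - c *\<^sub>R p n) < e"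
    by blast
qed

text \<open>The second components of \<open>q\<close> need not converge; the pair
  \<open>(f', g')\<close> of the adjoint replaces their limit. Cauchy-Schwarz for the form, with
  \<open>p\<close> bounded in form and \<open>q\<close> form-Cauchy, makes the replacement error
  vanish.\<close>

lemma form_limit:
  assumes pV: "\<And>n. p n \<in> V" and p: "form_Cauchy p" and pf: "(\<lambda>n. fst (p n)) \<longlonglongrightarrow> f"
    and qV: "\<And>n. q n \<in> V" and q: "form_Cauchy q" and qf: "(\<lambda>n. fst (q n)) \<longlonglongrightarrow> f'"
    and adj: "(f', g') \<in> radj V"
  shows "(\<lambda>n. fst (p n) \<bullet> snd (q n)) \<longlonglongrightarrow> f \<bullet> g'"
proof -
  obtain M N0 where M: "M > 0" and N0: "\<And>n. n \<ge> N0 \<Longrightarrow> fst (p n) \<bullet> snd (p n) \<le> M"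
    using form_Cauchy_bounded[OF pV p] by blast
  have "(\<lambda>n. fst (p n) \<bullet> snd (q n) - fst (p n) \<bullet> g') \<longlonglongrightarrow> 0"
  proof (rule LIMSEQ_I)
    fix r :: real assume "r > 0"
    then have "(r/2)\<^sup>2 / M > 0" using M by simp
    then obtain N where N: "\<And>m n. m \<ge> N \<Longrightarrow> n \<ge> N \<Longrightarrow> fst (q m - q n) \<bullet> snd (q m - q n) < (r/2)\<^sup>2 / M"
      using q unfolding form_Cauchy_def by blast
    have "norm (fst (p n) \<bullet> snd (q n) - fst (p n) \<bullet> g' - 0) < r" if n: "n \<ge> max N N0" for n
    proof -
      \<comment> \<open>By symmetry this is the form of \<open>p n\<close> against
        \<open>q n - q m\<close>. The estimate is uniform in \<open>m\<close>, so letting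
        \<open>m\<close> tend to infinity uses only the convergence of
        \<open>fst (q m)\<close>.\<close>
      have le: "\<bar>fst (p n) \<bullet> snd (q n) - snd (p n) \<bullet> fst (q m)\<bar> \<le> r/2" if "m \<ge> N" for m
      proof -
        have d: "q n - q m \<in> V" by (rule subspace_diff[OF form_subspace qV qV])
        have "(fst (p n) \<bullet> snd (q n) - snd (p n) \<bullet> fst (q m))\<^sup>2 = (fst (p n) \<bullet> snd (q n - q m))\<^sup>2"
          using form_sym[OF pV qV, of n m] by (simp add: inner_diff_right inner_commute)
        also have "\<dots> \<le> (fst (p n) \<bullet> snd (p n)) * (fst (q n - q m) \<bullet> snd (q n - q m))"
          by (rule form_cs[OF pV d])
        also have "\<dots> \<le> M * ((r/2)\<^sup>2 / M)"
          using N0[of n] N[of n m] n that M form_pos[OF d] by (intro mult_mono) auto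
        finally have "(fst (p n) \<bullet> snd (q n) - snd (p n) \<bullet> fst (q m))\<^sup>2 \<le> (r/2)\<^sup>2" using M by simp
        then show ?thesis using \<open>r > 0\<close> by (metis abs_le_square_iff abs_of_pos half_gt_zero)
      qed
      have "(\<lambda>m. \<bar>fst (p n) \<bullet> snd (q n) - snd (p n) \<bullet> fst (q m)\<bar>)
          \<longlonglongrightarrow> \<bar>fst (p n) \<bullet> snd (q n) - snd (p n) \<bullet> f'\<bar>"
        by (intro tendsto_intros qf)
      then have "\<bar>fst (p n) \<bullet> snd (q n) - snd (p n) \<bullet> f'\<bar> \<le> r/2"
        by (rule Lim_bounded[where M=N]) (use le in blast)
      moreover have "snd (p n) \<bullet> f' = fst (p n) \<bullet> g'"
        using radjD[OF adj, of "fst (p n)" "snd (p n)"] pV by simp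
      ultimately show ?thesis using \<open>r > 0\<close> by simp
    qed
    then show "\<exists>no. \<forall>n\<ge>no. norm (fst (p n) \<bullet> snd (q n) - fst (p n) \<bullet> g' - 0) < r" by blast
  qed
  moreover have "(\<lambda>n. fst (p n) \<bullet> g') \<longlonglongrightarrow> f \<bullet> g'" by (intro tendsto_intros pf)
  ultimately show ?thesis using Lim_transform by fastforce
qed

lemma fried_extends: "V \<subseteq> fried V"
proof
  fix v assume v: "v \<in> V"
  have "v \<in> radj V" using v V by (auto simp: nonneg_sym_def)
  moreover have "form_Cauchy (\<lambda>_. v)" by (simp add: form_Cauchy_def)
  ultimately show "v \<in> fried V" using v by (intro friedI[where p="\<lambda>_. v"]) auto
qed

text \<open>Sums and multiples are inherited from the approximating sequences. Symmetry comes from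
  evaluating the limit of the form of \<open>p n\<close> against \<open>q n\<close> in two ways with
  \<open>form_limit\<close>, and positivity from the limit of the form of \<open>p n\<close> against
  itself.\<close>

lemma nonneg_sym_fried: "nonneg_sym (fried V)"
  unfolding nonneg_sym_def
proof (intro conjI)
  show "subspace (fried V)"
  proof (rule subspaceI)
    show "0 \<in> fried V" using fried_extends subspace_0[OF form_subspace] by blast
  next
    fix x y assume "x \<in> fried V" "y \<in> fried V"
    then obtain p q where x: "x \<in> radj V" "\<And>n. p n \<in> V" "(\<lambda>n. fst (p n)) \<longlonglongrightarrow> fst x" "form_Cauchy p"
      and y: "y \<in> radj V" "\<And>n. q n \<in> V" "(\<lambda>n. fst (q n)) \<longlonglongrightarrow> fst y" "form_Cauchy q"
      by (metis friedE prod.collapse)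
    have "x + y \<in> radj V" using x y subspace_add subspace_radj by blast
    moreover have "(\<lambda>n. fst (p n + q n)) \<longlonglongrightarrow> fst (x + y)"
      unfolding fst_add by (intro tendsto_add x y)
    ultimately show "x + y \<in> fried V"
      by (rule friedI[OF _ subspace_add[OF form_subspace x(2) y(2)] _ form_Cauchy_add[OF x(2,4) y(2,4)]])
  next
    fix c x assume "x \<in> fried V"
    then obtain p where x: "x \<in> radj V" "\<And>n. p n \<in> V" "(\<lambda>n. fst (p n)) \<longlonglongrightarrow> fst x" "form_Cauchy p"
      by (metis friedE prod.collapse)
    have "c *\<^sub>R x \<in> radj V" using x subspace_mul subspace_radj by blast
    moreover have "(\<lambda>n. fst (c *\<^sub>R p n)) \<longlonglongrightarrow> fst (c *\<^sub>R x)"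
      unfolding fst_scaleR by (intro tendsto_intros x)
    ultimately show "c *\<^sub>R x \<in> fried V"
      by (rule friedI[OF _ subspace_mul[OF form_subspace x(2)] _ form_Cauchy_scaleR[OF x(4)]])
  qed
  show "fried V \<subseteq> radj (fried V)"
  proof safe
    fix f g assume fg: "(f, g) \<in> fried V"
    show "(f, g) \<in> radj (fried V)"
    proof (rule radjI)
      fix f' g' assume "(f', g') \<in> fried V"
      then obtain p q where
        *: "(f, g) \<in> radj V" "\<And>n. p n \<in> V" "(\<lambda>n. fst (p n)) \<longlonglongrightarrow> f" "form_Cauchy p"
        "(f', g') \<in> radj V" "\<And>n. q n \<in> V" "(\<lambda>n. fst (q n)) \<longlonglongrightarrow> f'" "form_Cauchy q"
        using fg by (metis friedE)
      have "(\<lambda>n. fst (p n) \<bullet> snd (q n)) \<longlonglongrightarrow> f \<bullet> g'" by (rule form_limit) (use * in auto)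
      moreover have "(\<lambda>n. fst (q n) \<bullet> snd (p n)) \<longlonglongrightarrow> f' \<bullet> g" by (rule form_limit) (use * in auto)
      ultimately show "g' \<bullet> f = f' \<bullet> g"
        using form_sym[OF *(2) *(6)] by (metis (no_types, lifting) LIMSEQ_unique ext inner_commute)
    qed
  qed
  show "\<forall>(x, y)\<in>fried V. 0 \<le> x \<bullet> y"
  proof safe
    fix f g assume "(f, g) \<in> fried V"
    then obtain p where
      *: "(f, g) \<in> radj V" "\<And>n. p n \<in> V" "(\<lambda>n. fst (p n)) \<longlonglongrightarrow> f" "form_Cauchy p"
      by (metis friedE)
    have "(\<lambda>n. fst (p n) \<bullet> snd (p n)) \<longlonglongrightarrow> f \<bullet> g" by (rule form_limit) (use * in auto)
    then show "0 \<le> f \<bullet> g" by (rule Lim_bounded2[of _ _ 0]) (use form_pos *(2) in auto)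
  qed
qed

end

text \<open>The resolvent equation \<open>f + T f = h\<close> is solved by a minimising sequence of
  \<open>\<parallel>f\<parallel>\<^sup>2 + t[f] - 2 \<langle>h, f\<rangle>\<close>.\<close>

lemma fried_total:
  fixes V :: "('a::{real_inner,banach} \<times> 'a) set"
  assumes V: "nonneg_sym V"
  shows "\<exists>f. (f, h - f) \<in> fried V"
proof -
  define a where "a p q = fst p \<bullet> fst q + fst p \<bullet> snd q" for p q :: "'a \<times> 'a"
  have "bilinear a"
    by (auto simp: a_def bilinear_def inner_add_left inner_add_right algebra_simps intro!: linearI)
  moreover have "a p q = a q p" if "p \<in> V" "q \<in> V" for p q
    using form_sym[OF V that] by (simp add: a_def inner_commute)
  moreover have "0 \<le> a p p" if "p \<in> V" for p
    using form_pos[OF V that] by (simp add: a_def)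
  moreover have "linear (\<lambda>p::'a\<times>'a. h \<bullet> fst p)"
    by (auto simp: inner_add_right intro!: linearI)
  moreover have "0 \<le> (norm h)\<^sup>2" by simp
  moreover have "(h \<bullet> fst p)\<^sup>2 \<le> (norm h)\<^sup>2 * a p p" if "p \<in> V" for p
  proof -
    have "(h \<bullet> fst p)\<^sup>2 \<le> (h \<bullet> h) * (fst p \<bullet> fst p)" by (rule Cauchy_Schwarz_ineq)
    also have "\<dots> \<le> (h \<bullet> h) * a p p"
      using form_pos[OF V that] by (intro mult_left_mono) (auto simp: a_def)
    finally show ?thesis by (simp add: power2_norm_eq_inner)
  qed
  ultimately obtain p where pV: "\<And>n. p n \<in> V"
    and pc: "\<And>m n. a (p m - p n) (p m - p n) \<le> 2 / real (Suc m) + 2 / real (Suc n)"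
    and pl: "\<And>q. q \<in> V \<Longrightarrow> (\<lambda>n. a (p n) q) \<longlonglongrightarrow> h \<bullet> fst q"
    using approx_riesz[OF form_subspace[OF V], of a "\<lambda>p. h \<bullet> fst p" "(norm h)\<^sup>2"] by blast
  note small = reciprocal_bound_small[OF pc]
  \<comment> \<open>The form \<open>a\<close> is the sum of two nonnegative parts, so smallness of
    \<open>a\<close> gives both the form-Cauchy property and norm convergence of the first
    components.\<close>
  have ge: "fst (p m - p n) \<bullet> snd (p m - p n) \<le> a (p m - p n) (p m - p n)"
    "(norm (fst (p m) - fst (p n)))\<^sup>2 \<le> a (p m - p n) (p m - p n)" for m n
    using form_pos[OF V subspace_diff[OF form_subspace[OF V] pV pV], of m n]
    by (auto simp: a_def power2_norm_eq_inner)
  have fc: "form_Cauchy p" unfolding form_Cauchy_def using small ge(1) by (meson order.strict_trans1)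
  have "Cauchy (\<lambda>n. fst (p n))"
    by (rule CauchyI_power2) (use small ge(2) in \<open>meson order.strict_trans1\<close>)
  then obtain f where f: "(\<lambda>n. fst (p n)) \<longlonglongrightarrow> f" using Cauchy_convergent convergent_def by blast
  have "(f, h - f) \<in> radj V"
  proof (rule radjI)
    fix x w assume "(x, w) \<in> V"
    then have "(\<lambda>n. a (p n) (x, w)) \<longlonglongrightarrow> h \<bullet> x" using pl by fastforce
    moreover have "(\<lambda>n. a (p n) (x, w)) \<longlonglongrightarrow> f \<bullet> x + f \<bullet> w"
      unfolding a_def by (auto intro!: tendsto_intros f)
    ultimately have "h \<bullet> x = f \<bullet> x + f \<bullet> w" by (rule LIMSEQ_unique)
    then show "w \<bullet> f = x \<bullet> (h - f)" by (simp add: inner_commute inner_diff_right)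
  qed
  then show ?thesis unfolding fried_def using pV f fc by blast
qed

section \<open>Square roots of selfadjoint relations\<close>

text \<open>A square root \<open>F\<close> of \<open>C\<close> commutes with \<open>E\<close>, so
  \<open>C x \<bullet> E x = E (F x) \<bullet> F x\<close>. The contraction bound serves to put
  \<open>C\<close> between 0 and 1, where the square root is available.\<close>

lemma pos_bl_commuting:
  fixes C :: "'a::{real_inner,banach} \<Rightarrow>\<^sub>L 'a"
  assumes C: "pos_bl C" and le: "\<And>x. norm (C x) \<le> norm x" and E: "pos_bl E"
    and comm: "\<And>x. C (E x) = E (C x)"
  shows "0 \<le> C x \<bullet> E x"
proof -
  have "C x \<bullet> C x \<le> C x \<bullet> x" for x
  proof -
    have bil: "bilinear (\<lambda>x y. C x \<bullet> y)"
      by (auto simp: bilinear_def blinfun.add_right blinfun.scaleR_right inner_add_left inner_add_right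
          intro!: linearI)
    \<comment> \<open>Cauchy-Schwarz for the semidefinite form \<open>C x \<bullet> y\<close> at
      \<open>x\<close> and \<open>C x\<close>; the contraction bound then allows one factor
      \<open>C x \<bullet> C x\<close> to be cancelled.\<close>
    have "(C x \<bullet> C x)\<^sup>2 \<le> (C x \<bullet> x) * (C (C x) \<bullet> C x)"
      by (rule psd_cauchy_schwarz[OF subspace_UNIV bil])
        (use pos_bl_sym[OF C] pos_bl_nonneg[OF C] in \<open>auto simp: inner_commute\<close>)
    also have "\<dots> \<le> (C x \<bullet> x) * (C x \<bullet> C x)"
    proof (rule mult_left_mono[OF _ pos_bl_nonneg[OF C]])
      have "C (C x) \<bullet> C x \<le> norm (C (C x)) * norm (C x)" by (rule norm_cauchy_schwarz)
      also have "\<dots> \<le> norm (C x) * norm (C x)" by (intro mult_right_mono le) simp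
      finally show "C (C x) \<bullet> C x \<le> C x \<bullet> C x" by (simp add: norm_eq_sqrt_inner)
    qed
    finally show ?thesis
      using pos_bl_nonneg[OF C, of x] by (cases "C x = 0") (auto simp: power2_eq_square)
  qed
  then have "unit_bl C" using pos_bl_sym[OF C] by (simp add: unit_bl_def)
  then obtain F where F: "pos_bl F" "F o\<^sub>L F = C" and "\<And>J. J o\<^sub>L C = C o\<^sub>L J \<Longrightarrow> J o\<^sub>L F = F o\<^sub>L J"
    using unit_bl_sqrt by blast
  moreover have "E o\<^sub>L C = C o\<^sub>L E" by (rule blinfun_eqI) (simp add: comm)
  ultimately have "E o\<^sub>L F = F o\<^sub>L E" by blast
  then have "F (E x) = E (F x)" by (metis blinfun_apply_blinfun_compose)
  moreover have "C x \<bullet> E x = F x \<bullet> F (E x)"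
    using F(2) pos_bl_sym[OF F(1)] by (metis blinfun_apply_blinfun_compose)
  ultimately show ?thesis using pos_bl_nonneg[OF E, of "F x"] by (simp add: inner_commute)
qed

text \<open>With \<open>D = P - Q\<close>, commutation gives \<open>(P + Q) D = 0\<close>. Both
  \<open>P\<close> and \<open>Q\<close> are nonnegative on the range of \<open>D\<close>, so their
  forms vanish there, hence so does that of \<open>D\<close>; symmetry then forces
  \<open>D = 0\<close>.\<close>

lemma pos_bl_sqrt_unique:
  assumes P: "pos_bl P" and Q: "pos_bl Q"
    and comm: "\<And>x. P (Q x) = Q (P x)" and sq: "\<And>x. P (P x) = Q (Q x)"
  shows "P x = Q x"
proof -
  define D where "D = P - Q"
  have D: "D x = P x - Q x" for x by (simp add: D_def blinfun.diff_left)
  have symD: "D x \<bullet> y = x \<bullet> D y" for x y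
    by (simp add: D inner_diff_left inner_diff_right pos_bl_sym[OF P] pos_bl_sym[OF Q])
  have zero: "D (D x) \<bullet> D x = 0" for x
  proof -
    have "P (D x) + Q (D x) = 0" by (simp add: D blinfun.diff_right comm sq)
    then have "P (D x) \<bullet> D x + Q (D x) \<bullet> D x = 0" by (metis inner_add_left inner_zero_left)
    then show ?thesis
      using pos_bl_nonneg[OF P, of "D x"] pos_bl_nonneg[OF Q, of "D x"]
      by (simp add: D[of "D x"] inner_diff_left)
  qed
  \<comment> \<open>Polarisation of \<open>zero\<close>; putting \<open>D x\<close> for
    \<open>y\<close> gives \<open>D (D x) = 0\<close>.\<close>
  have "D (D x) \<bullet> D y = 0" for x y
    using zero[of "x + y"] zero[of x] zero[of y] symD[of "D x" "D y"]
    by (simp add: blinfun.add_right inner_add_left inner_add_right inner_commute)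
  from this[of x "D x"] have "D (D x) = 0" by simp
  then have "D x \<bullet> D x = 0" by (simp add: symD)
  then show ?thesis by (simp add: D)
qed

text \<open>The range of a symmetric operator is orthogonal to its kernel, so \<open>d\<close> is
  orthogonal to itself.\<close>

lemma pos_bl_range_ker:
  assumes C: "pos_bl C" and d: "d \<in> closure (range C)" and z: "C d = 0"
  shows "d = 0"
proof -
  obtain r where r: "r \<longlonglongrightarrow> d" "\<And>n. r n \<in> range C"
    using d unfolding closure_sequential by blast
  then have "r n \<bullet> d = 0" for n using pos_bl_sym[OF C] z by (metis imageE inner_zero_right)
  moreover have "(\<lambda>n. r n \<bullet> d) \<longlonglongrightarrow> d \<bullet> d" by (intro tendsto_intros r)
  ultimately show ?thesis using LIMSEQ_unique tendsto_const by (metis (no_types, lifting) ext inner_eq_zero_iff)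
qed

text \<open>A nonnegative selfadjoint \<open>T\<close> with \<open>(1 + T)\<^sup>-\<^sup>1 = C\<^sup>2\<close> and \<open>E\<^sup>2 = 1 - C\<^sup>2\<close>
  is the graph \<open>{(C\<^sup>2 x, E\<^sup>2 x)}\<close>, and its square root is \<open>{(C x, E x)}\<close>.\<close>

locale sqrt_pair =
  fixes T :: "('a::{real_inner,banach} \<times> 'a) set" and C E :: "'a \<Rightarrow>\<^sub>L 'a"
  assumes posC: "pos_bl C" and posE: "pos_bl E"
    and CE: "C (E x) = E (C x)"
    and CCEE: "C (C x) + E (E x) = x"
    and T_eq: "T = range (\<lambda>x. (C (C x), E (E x)))"
    and commute: "\<And>J :: 'a \<Rightarrow>\<^sub>L 'a. (\<And>x y. (x, y) \<in> T \<Longrightarrow> (J x, J y) \<in> T) \<Longrightarrow>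
      (\<forall>x. J (C x) = C (J x)) \<and> (\<forall>x. J (E x) = E (J x))"

text \<open>Totality and positivity turn \<open>(1 + N)\<^sup>-\<^sup>1\<close> into an everywhere
  defined operator \<open>b\<close> between 0 and 1. The operators \<open>C\<close> and
  \<open>E\<close> are the square roots of \<open>b\<close> and \<open>1 - b\<close>; an operator
  preserving \<open>N\<close> commutes with \<open>b\<close>, hence with both roots.\<close>

lemma sqrt_pair_exists:
  fixes N :: "('a::{real_inner,banach} \<times> 'a) set"
  assumes N: "nonneg_sym N" and tot: "\<And>h. \<exists>f. (f, h - f) \<in> N"
  shows "\<exists>C E. sqrt_pair N C E"
proof -
  note sub = form_subspace[OF N]
  have uniq: "f = f'" if "(f, h - f) \<in> N" "(f', h - f') \<in> N" for f f' h
  proof -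
    \<comment> \<open>Two solutions differ by a pair \<open>(d, - d)\<close> in \<open>N\<close>,
      and positivity of \<open>d \<bullet> (- d)\<close> forces \<open>d = 0\<close>.\<close>
    have "(f - f', - (f - f')) \<in> N" using subspace_diff[OF sub that] by simp
    then have "0 \<le> (f - f') \<bullet> - (f - f')" using form_pos[OF N] by fastforce
    then have "(f - f') \<bullet> (f - f') \<le> 0" unfolding inner_minus_right by simp
    then show ?thesis using inner_ge_zero[of "f - f'"] by (metis antisym eq_iff_diff_eq_0 inner_eq_zero_iff)
  qed
  define b where "b h = (THE f. (f, h - f) \<in> N)" for h
  have bN: "(b h, h - b h) \<in> N" for h
    unfolding b_def using tot[of h] uniq by (metis (no_types, lifting) theI)
  have bI: "b h = f" if "(f, h - f) \<in> N" for f h using uniq bN that by blast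
  have b_le: "b x \<bullet> b x \<le> b x \<bullet> x" for x
    using form_pos[OF N bN[of x]] by (simp add: inner_diff_right)
  have "bounded_linear b"
  proof (rule bounded_linear_intro)
    show "b (x + y) = b x + b y" for x y
      by (rule bI) (use subspace_add[OF sub bN[of x] bN[of y]] in \<open>simp add: algebra_simps\<close>)
    show "b (r *\<^sub>R x) = r *\<^sub>R b x" for r x
      by (rule bI) (use subspace_mul[OF sub bN[of x], of r] in \<open>simp add: scaleR_right_diff_distrib\<close>)
    show "norm (b x) \<le> norm x * 1" for x
    proof -
      have "(norm (b x))\<^sup>2 \<le> b x \<bullet> x" using b_le by (simp add: power2_norm_eq_inner)
      also have "\<dots> \<le> norm (b x) * norm x" by (rule norm_cauchy_schwarz)
      finally show ?thesis by (cases "norm (b x) = 0") (auto simp: power2_eq_square)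
    qed
  qed
  define B where "B = Blinfun b"
  have Bb: "blinfun_apply B = b" unfolding B_def by (rule bounded_linear_Blinfun_apply) fact
  have symB: "b x \<bullet> y = x \<bullet> b y" for x y
    using form_sym[OF N bN[of x] bN[of y]] by (simp add: inner_diff_right inner_commute)
  have "unit_bl B" using symB b_le by (simp add: unit_bl_def Bb)
  moreover from this have "unit_bl (id_blinfun - B)" by (rule unit_bl_complement)
  ultimately obtain C E where C: "pos_bl C" "C o\<^sub>L C = B" "\<And>J. J o\<^sub>L B = B o\<^sub>L J \<Longrightarrow> J o\<^sub>L C = C o\<^sub>L J"
    and E: "pos_bl E" "E o\<^sub>L E = id_blinfun - B"
      "\<And>J. J o\<^sub>L (id_blinfun - B) = (id_blinfun - B) o\<^sub>L J \<Longrightarrow> J o\<^sub>L E = E o\<^sub>L J"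
    by (meson unit_bl_sqrt)
  have CC: "C (C x) = b x" for x using C(2) Bb by (metis blinfun_apply_blinfun_compose)
  have EE: "E (E x) = x - b x" for x
    using arg_cong[OF E(2), of "\<lambda>f. blinfun_apply f x"] by (simp add: blinfun.diff_left Bb)
  have comm: "(\<forall>x. J (C x) = C (J x)) \<and> (\<forall>x. J (E x) = E (J x))" if "\<And>x. J (b x) = b (J x)" for J :: "'a \<Rightarrow>\<^sub>L 'a"
  proof -
    have "J o\<^sub>L B = B o\<^sub>L J" by (rule blinfun_eqI) (simp add: Bb that)
    then have "J o\<^sub>L C = C o\<^sub>L J" by (rule C(3))
    moreover have "J o\<^sub>L (id_blinfun - B) = (id_blinfun - B) o\<^sub>L J"
      by (rule blinfun_eqI) (simp add: Bb that blinfun.diff_left blinfun.diff_right)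
    then have "J o\<^sub>L E = E o\<^sub>L J" by (rule E(3))
    ultimately show ?thesis by (metis blinfun_apply_blinfun_compose)
  qed
  have "sqrt_pair N C E"
  proof
    show "pos_bl C" "pos_bl E" by fact+
    show "C (C x) + E (E x) = x" for x by (simp add: CC EE)
    have "C (b x) = b (C x)" for x by (simp flip: CC)
    then show "C (E x) = E (C x)" for x using comm by blast
    have "(x, y) = (b (x + y), (x + y) - b (x + y))" if "(x, y) \<in> N" for x y
      using bI[of x "x + y"] that by simp
    then have "(x, y) \<in> range (\<lambda>x. (b x, x - b x))" if "(x, y) \<in> N" for x y using that by blast
    then show "N = range (\<lambda>x. (C (C x), E (E x)))"
      unfolding CC EE using bN by auto
    fix J :: "'a \<Rightarrow>\<^sub>L 'a" assume J: "\<And>x y. (x, y) \<in> N \<Longrightarrow> (J x, J y) \<in> N"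
    have "J (b x) = b (J x)" for x
      by (rule bI[symmetric]) (use J[OF bN[of x]] in \<open>simp add: blinfun.diff_right\<close>)
    then show "(\<forall>x. J (C x) = C (J x)) \<and> (\<forall>x. J (E x) = E (J x))" by (rule comm)
  qed
  then show ?thesis by blast
qed

text \<open>For selfadjoint \<open>T\<close>, \<open>fried T\<close> is contained in
  \<open>radj T = T\<close>, so the solvability of the resolvent equation in
  \<open>fried_total\<close> applies to \<open>T\<close> itself.\<close>

lemma nonneg_sa_sqrt_pair:
  assumes "nonneg_sa T" shows "\<exists>C E. sqrt_pair T C E"
proof (rule sqrt_pair_exists)
  show "nonneg_sym T" using assms by (rule nonneg_sa_imp_sym)
  then show "\<exists>f. (f, h - f) \<in> T" for h
    using fried_total[of T h] assms by (auto simp: fried_def nonneg_sa_def)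
qed

section \<open>The graph of an operator and of its square root\<close>

context sqrt_pair
begin

lemma symC: "C x \<bullet> y = x \<bullet> C y" and symE: "E x \<bullet> y = x \<bullet> E y"
  using pos_bl_sym posC posE by auto

lemma pythagoras: "(norm (C x))\<^sup>2 + (norm (E x))\<^sup>2 = (norm x)\<^sup>2"
proof -
  have "x \<bullet> x = x \<bullet> C (C x) + x \<bullet> E (E x)" by (metis CCEE inner_add_right)
  then show ?thesis by (simp add: power2_norm_eq_inner symC symE)
qed

lemma memT: "(C (C x), E (E x)) \<in> T" by (simp add: T_eq)

definition "S = range (\<lambda>x. (C x, E x))"

lemma memS: "(C x, E x) \<in> S" by (simp add: S_def)

text \<open>The parameter of a point \<open>(y, z)\<close> is recovered as \<open>y + z\<close>,
  because \<open>C\<^sup>2\<close> is the resolvent \<open>(1 + T)\<^sup>-\<^sup>1\<close>. The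
  equation turns questions about the graph into algebra of commuting bounded operators.\<close>

lemma T_iff: "(y, z) \<in> T \<longleftrightarrow> E (E y) = C (C z)"
proof
  assume "E (E y) = C (C z)"
  then have "C (C (y + z)) = y" "E (E (y + z)) = z"
    using CCEE[of y] CCEE[of z] by (simp_all add: blinfun.add_right add.commute)
  then show "(y, z) \<in> T" using memT[of "y + z"] by simp
qed (auto simp: T_eq CE)

lemma S_iff: "(y, z) \<in> S \<longleftrightarrow> E y = C z"
proof
  assume "E y = C z"
  then have "C (C y + E z) = y" "E (C y + E z) = z"
    using CCEE[of y] CCEE[of z] by (simp_all add: blinfun.add_right CE[symmetric])
  then show "(y, z) \<in> S" using memS[of "C y + E z"] by simp
qed (auto simp: S_def CE)

lemma T_resolvent: "(u, w) \<in> T \<Longrightarrow> C (C (u + w)) = u \<and> E (E (u + w)) = w"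
  using CCEE[of u] CCEE[of w] by (auto simp: T_iff blinfun.add_right add.commute)

lemma comp_S: "comp_op S S = T"
proof safe
  fix x z assume "(x, z) \<in> comp_op S S"
  then obtain y where "E x = C y" "E y = C z" by (auto simp: comp_op_def S_iff)
  then show "(x, z) \<in> T" by (simp add: T_iff CE[symmetric])
next
  fix x z assume "(x, z) \<in> T"
  then obtain v where "x = C (C v)" "z = E (E v)" by (auto simp: T_eq)
  moreover have "(C (C v), E (C v)) \<in> S" "(C (E v), E (E v)) \<in> S" by (rule memS)+
  ultimately show "(x, z) \<in> comp_op S S" unfolding comp_op_def by (auto simp: CE)
qed

lemma nonneg_sa_T: "nonneg_sa T"
  unfolding nonneg_sa_def
proof (intro conjI)
  show "radj T = T"
  proof safe
    fix y z assume *: "(y, z) \<in> radj T"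
    have "x \<bullet> (E (E y) - C (C z)) = 0" for x
      using radjD[OF * memT[of x]] by (simp add: inner_diff_right symC symE)
    then have "E (E y) - C (C z) = 0" by (metis inner_eq_zero_iff)
    then show "(y, z) \<in> T" by (simp add: T_iff)
  next
    fix y z assume "(y, z) \<in> T"
    then show "(y, z) \<in> radj T"
      by (intro radjI) (auto simp: T_iff T_eq symC symE CE)
  qed
  then show "subspace T" using subspace_radj by metis
  have "C (C x) \<bullet> E (E x) = E (C x) \<bullet> E (C x)" for x by (simp add: symC symE CE)
  then show "\<forall>(x, y)\<in>T. 0 \<le> x \<bullet> y" by (auto simp: T_eq)
qed

lemma nonneg_sa_S: "nonneg_sa S"
  unfolding nonneg_sa_def
proof (intro conjI)
  show "radj S = S"
  proof safe
    fix y z assume *: "(y, z) \<in> radj S"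
    have "x \<bullet> (E y - C z) = 0" for x
      using radjD[OF * memS[of x]] by (simp add: inner_diff_right symC symE)
    then have "E y - C z = 0" by (metis inner_eq_zero_iff)
    then show "(y, z) \<in> S" by (simp add: S_iff)
  next
    fix y z assume "(y, z) \<in> S"
    then show "(y, z) \<in> radj S"
      by (intro radjI) (auto simp: S_iff S_def symC symE CE)
  qed
  then show "subspace S" using subspace_radj by metis
  \<comment> \<open>Positivity of \<open>S\<close> is positivity of the product of the commuting
    operators \<open>C\<close> and \<open>E\<close>.\<close>
  have "norm (C x) \<le> norm x" for x
    using pythagoras[of x] by (metis le_add_same_cancel1 norm_ge_zero power2_le_imp_le zero_le_power2)
  then have "0 \<le> C x \<bullet> E x" for x
    by (rule pos_bl_commuting[OF posC _ posE CE])
  then show "\<forall>(x, y)\<in>S. 0 \<le> x \<bullet> y" by (auto simp: S_def)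
qed

text \<open>Another root \<open>S'\<close> has its own pair \<open>C'\<close>, \<open>E'\<close>.
  These preserve \<open>S'\<close>, hence \<open>T\<close>, and so commute with \<open>C\<close> and
  \<open>E\<close>; comparing the roots is thereby reduced to uniqueness of bounded positive square
  roots.\<close>

lemma S_unique:
  assumes S': "nonneg_sa S'" and comp: "comp_op S' S' = T"
  shows "S' = S"
proof -
  obtain C' E' where "sqrt_pair S' C' E'" using nonneg_sa_sqrt_pair[OF S'] by blast
  then interpret R: sqrt_pair S' C' E' .
  have JT: "(J x, J y) \<in> T" if xy: "(x, y) \<in> T" and J: "\<And>x. J (C' x) = C' (J x)" "\<And>x. J (E' x) = E' (J x)"
    for J :: "'a \<Rightarrow>\<^sub>L 'a" and x y
  proof -
    obtain z where "(x, z) \<in> S'" "(z, y) \<in> S'" using xy unfolding comp[symmetric] comp_op_def by blast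
    then have "(J x, J z) \<in> S'" "(J z, J y) \<in> S'" by (simp_all add: R.T_iff flip: J)
    then show ?thesis using comp by (auto simp: comp_op_def)
  qed
  have C'T: "C' (C x) = C (C' x)" "C' (E x) = E (C' x)" for x
    using commute[of C'] JT[of _ _ C'] by (auto simp: R.CE)
  have E'T: "E' (C x) = C (E' x)" "E' (E x) = E (E' x)" for x
    using commute[of E'] JT[of _ _ E'] by (auto simp: R.CE)
  \<comment> \<open>By \<open>R.T_iff\<close>, the point \<open>(C x, E x)\<close> lies in
    \<open>S'\<close> exactly when \<open>P x = Q x\<close>.\<close>
  define P where "P = E' o\<^sub>L (E' o\<^sub>L C)"
  define Q where "Q = C' o\<^sub>L (C' o\<^sub>L E)"
  have "P x = Q x" for x
  proof (rule pos_bl_sqrt_unique)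
    have "P x \<bullet> x = C (E' x) \<bullet> E' x" "Q x \<bullet> x = E (C' x) \<bullet> C' x" for x
      by (simp_all add: P_def Q_def R.symE R.symC symC symE E'T C'T)
    then have "0 \<le> P x \<bullet> x" "0 \<le> Q x \<bullet> x" for x
      using pos_bl_nonneg[OF posC] pos_bl_nonneg[OF posE] by auto
    moreover have "P x \<bullet> y = x \<bullet> P y" "Q x \<bullet> y = x \<bullet> Q y" for x y
      by (simp_all add: P_def Q_def R.symE R.symC symC symE E'T C'T)
    ultimately show "pos_bl P" "pos_bl Q" by (auto simp: pos_bl_def)
    show "P (Q x) = Q (P x)" for x
      by (simp add: P_def Q_def C'T E'T CE R.CE)
    show "P (P x) = Q (Q x)" for x
    proof -
      \<comment> \<open>Eliminating the intermediate point \<open>y\<close> of the composition gives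
        equality of the squares of \<open>P\<close> and \<open>Q\<close>.\<close>
      have "(C (C x), E (E x)) \<in> comp_op S' S'" using comp memT by simp
      then obtain y where y: "E' (E' (C (C x))) = C' (C' y)" "E' (E' y) = C' (C' (E (E x)))"
        by (auto simp: comp_op_def R.T_iff)
      have "P (P x) = E' (E' (E' (E' (C (C x)))))" by (simp add: P_def E'T)
      also have "\<dots> = C' (C' (E' (E' y)))" by (simp add: y(1) R.CE)
      also have "\<dots> = Q (Q x)" by (simp add: y(2) Q_def C'T)
      finally show ?thesis .
    qed
  qed
  then have "S \<subseteq> S'" by (auto simp: S_def R.T_iff P_def Q_def)
  moreover have "S' \<subseteq> S"
    \<comment> \<open>Taking adjoints reverses the inclusion, and both relations are
      selfadjoint.\<close>
    using radj_antimono[OF \<open>S \<subseteq> S'\<close>] S' nonneg_sa_S by (simp add: nonneg_sa_def)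
  ultimately show ?thesis by simp
qed

text \<open>Inverting the graph exchanges the roles of \<open>C\<close> and \<open>E\<close>; this
  carries facts about the Friedrichs extension over to the Krein extension.\<close>

lemma sqrt_pair_converse: "sqrt_pair (T\<inverse>) E C"
proof
  fix J :: "'a \<Rightarrow>\<^sub>L 'a" assume "\<And>x y. (x, y) \<in> T\<inverse> \<Longrightarrow> (J x, J y) \<in> T\<inverse>"
  then show "(\<forall>x. J (E x) = E (J x)) \<and> (\<forall>x. J (C x) = C (J x))" using commute[of J] by simp
next
  show "T\<inverse> = range (\<lambda>x. (E (E x), C (C x)))" by (auto simp: T_eq)
  show "E (E x) + C (C x) = x" for x using CCEE[of x] by (simp add: add.commute)
qed (use posC posE CE in auto)

text \<open>For \<open>(u, w)\<close> in \<open>V\<close>, \<open>C\<close> maps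
  \<open>C (u + w)\<close> to \<open>u\<close>, and the squared norm of \<open>C (u + w)\<close> is
  that of \<open>u\<close> plus \<open>u \<bullet> w\<close>. Hence a form-Cauchy sequence with
  first components tending to \<open>C (C x)\<close> lifts to a norm-Cauchy sequence of such
  vectors, whose limit is \<open>C x\<close>.\<close>

lemma fried_core:
  assumes V: "nonneg_sym V" and T: "T = fried V"
  shows "C x \<in> closure ((\<lambda>(u, w). C (u + w)) ` V)"
proof -
  have "(C (C x), E (E x)) \<in> fried V" using memT T by simp
  then obtain p where p: "\<And>n. p n \<in> V" "(\<lambda>n. fst (p n)) \<longlonglongrightarrow> C (C x)" "form_Cauchy p"
    by (metis friedE)
  define q where "q n = C (fst (p n) + snd (p n))" for n
  have pT: "(u, w) \<in> T" if "(u, w) \<in> V" for u w using fried_extends[OF V] that T by auto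
  have Cq: "C (q n) = fst (p n)" for n
    using T_resolvent pT p(1)[of n] by (metis q_def prod.collapse)
  have norm_q: "(norm (q m - q n))\<^sup>2
      = (norm (fst (p m) - fst (p n)))\<^sup>2 + fst (p m - p n) \<bullet> snd (p m - p n)" for m n
  proof -
    have d: "p m - p n \<in> V" using subspace_diff[OF form_subspace[OF V]] p(1) by blast
    let ?x = "fst (p m - p n) + snd (p m - p n)"
    have "q m - q n = C ?x" by (simp add: q_def blinfun.diff_right blinfun.add_right)
    then have "(norm (q m - q n))\<^sup>2 = (norm (C (C ?x)))\<^sup>2 + (norm (E (C ?x)))\<^sup>2" by (simp add: pythagoras)
    moreover have "(norm (E (C ?x)))\<^sup>2 = C (C ?x) \<bullet> E (E ?x)"
      by (simp add: power2_norm_eq_inner symC symE CE)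
    moreover have "C (C ?x) = fst (p m - p n)" "E (E ?x) = snd (p m - p n)"
      using T_resolvent pT d by (metis prod.collapse)+
    ultimately show ?thesis by simp
  qed
  have "Cauchy q"
  proof (rule CauchyI_power2)
    fix e :: real assume e: "e > 0"
    then obtain N1 where N1: "\<And>m n. m \<ge> N1 \<Longrightarrow> n \<ge> N1 \<Longrightarrow> fst (p m - p n) \<bullet> snd (p m - p n) < e / 2"
      using p(3) unfolding form_Cauchy_def by (metis half_gt_zero)
    have "Cauchy (\<lambda>n. fst (p n))" using p(2) by (rule LIMSEQ_imp_Cauchy)
    moreover have "0 < sqrt (e / 2)" using e by simp
    ultimately obtain N2 where N2: "\<And>m n. m \<ge> N2 \<Longrightarrow> n \<ge> N2 \<Longrightarrow> norm (fst (p m) - fst (p n)) < sqrt (e / 2)"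
      using CauchyD by metis
    have "(norm (q m - q n))\<^sup>2 < e" if "m \<ge> max N1 N2" "n \<ge> max N1 N2" for m n
    proof -
      have "(norm (fst (p m) - fst (p n)))\<^sup>2 \<le> (sqrt (e / 2))\<^sup>2"
        using N2[of m n] that by (intro power_mono) auto
      then show ?thesis using N1[of m n] that e unfolding norm_q by auto
    qed
    then show "\<exists>M. \<forall>m\<ge>M. \<forall>n\<ge>M. (norm (q m - q n))\<^sup>2 < e" by blast
  qed
  then obtain y where y: "q \<longlonglongrightarrow> y" using Cauchy_convergent convergent_def by blast
  have "(\<lambda>n. C (q n)) \<longlonglongrightarrow> C y" by (intro blinfun.tendsto tendsto_const y)
  then have "C y = C (C x)" using p(2) LIMSEQ_unique unfolding Cq by blast
  \<comment> \<open>The limit satisfies \<open>C y = C (C x)\<close>, but \<open>C\<close> may have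
    a kernel; since \<open>y - C x\<close> lies in the closed range of \<open>C\<close>, that kernel
    is harmless.\<close>
  moreover have "y - C x \<in> closure (range C)"
    unfolding closure_sequential
  proof (intro exI conjI allI)
    show "q n - C x \<in> range C" for n unfolding q_def by (metis blinfun.diff_right rangeI)
    show "(\<lambda>n. q n - C x) \<longlonglongrightarrow> y - C x" by (intro tendsto_intros y)
  qed
  ultimately have "y = C x" using pos_bl_range_ker[OF posC, of "y - C x"] by (simp add: blinfun.diff_right)
  moreover have "q n \<in> (\<lambda>(u, w). C (u + w)) ` V" for n
    unfolding q_def using p(1)[of n] by (force simp: image_iff split_beta)
  ultimately show ?thesis unfolding closure_sequential using y by blast
qed

end

section \<open>The Krein extension\<close>

lemma blinfun_image_closure: "x \<in> closure A \<Longrightarrow> blinfun_apply F x \<in> closure (blinfun_apply F ` A)"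
  using image_closure_subset[of A "blinfun_apply F" "closure (blinfun_apply F ` A)"]
    closure_subset[of "blinfun_apply F ` A"] linear_continuous_on[OF blinfun.bounded_linear_right, of "closure A" F]
  by auto

lemma nonneg_sym_converse:
  assumes "nonneg_sym V" shows "nonneg_sym (V\<inverse>)"
  unfolding nonneg_sym_def
proof (intro conjI)
  note sub = form_subspace[OF assms]
  show "subspace (V\<inverse>)"
  proof (rule subspaceI)
    show "0 \<in> V\<inverse>" using subspace_0[OF sub] by (simp add: zero_prod_def)
    show "x + y \<in> V\<inverse>" if "x \<in> V\<inverse>" "y \<in> V\<inverse>" for x y
      using that subspace_add[OF sub, of "(snd x, fst x)" "(snd y, fst y)"] by (cases x, cases y) auto
    show "c *\<^sub>R x \<in> V\<inverse>" if "x \<in> V\<inverse>" for c x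
      using that subspace_mul[OF sub, of "(snd x, fst x)" c] by (cases x) auto
  qed
  show "V\<inverse> \<subseteq> radj (V\<inverse>)"
  proof safe
    fix x y assume "(x, y) \<in> V"
    then show "(y, x) \<in> radj (V\<inverse>)"
      using form_sym[OF assms] by (intro radjI) (force simp: inner_commute)
  qed
  show "\<forall>(x, y)\<in>V\<inverse>. 0 \<le> x \<bullet> y" using form_pos[OF assms] by (force simp: inner_commute)
qed

text \<open>Equal norms polarise to equal bilinear forms. If \<open>h\<close> is the image of
  \<open>f\<close> under the square of \<open>S1\<close>, then the form identity puts
  \<open>(s', h)\<close> into the adjoint of \<open>S2\<close>, which is \<open>S2\<close>.\<close>

lemma comp_op_determined:
  assumes S1: "nonneg_sa S1" and S2: "nonneg_sa S2" and dom: "dom_op S1 = dom_op S2"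
    and norm: "\<And>f s s'. (f, s) \<in> S1 \<Longrightarrow> (f, s') \<in> S2 \<Longrightarrow> norm s = norm s'"
  shows "comp_op S1 S1 \<subseteq> comp_op S2 S2"
proof safe
  note sub = S1[unfolded nonneg_sa_def, THEN conjunct1] S2[unfolded nonneg_sa_def, THEN conjunct1]
  fix f h assume "(f, h) \<in> comp_op S1 S1"
  then obtain s where s: "(f, s) \<in> S1" "(s, h) \<in> S1" by (auto simp: comp_op_def)
  have "f \<in> dom_op S2" using s(1) dom by (force simp: dom_op_def)
  then obtain s' where s': "(f, s') \<in> S2" by (auto simp: dom_op_def)
  have "(s', h) \<in> radj S2"
  proof (rule radjI)
    fix g t' assume t': "(g, t') \<in> S2"
    then have "g \<in> dom_op S1" using dom by (force simp: dom_op_def)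
    then obtain t where t: "(g, t) \<in> S1" by (auto simp: dom_op_def)
    have "(f + g, s + t) \<in> S1" "(f + g, s' + t') \<in> S2"
      using subspace_add[OF sub(1) s(1) t] subspace_add[OF sub(2) s' t'] by auto
    then have "(norm (s + t))\<^sup>2 = (norm (s' + t'))\<^sup>2" "(norm s)\<^sup>2 = (norm s')\<^sup>2" "(norm t)\<^sup>2 = (norm t')\<^sup>2"
      using norm s(1) s' t t' by metis+
    then have "t' \<bullet> s' = t \<bullet> s"
      by (simp add: power2_norm_eq_inner inner_add_left inner_add_right inner_commute)
    also have "\<dots> = g \<bullet> h" using S1 s(2) t radjD[of s h S1] by (simp add: nonneg_sa_def)
    finally show "t' \<bullet> s' = g \<bullet> h" .
  qed
  then have "(s', h) \<in> S2" using S2 by (simp add: nonneg_sa_def)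
  with s' show "(f, h) \<in> comp_op S2 S2" by (auto simp: comp_op_def)
qed

section \<open>Core, range and minimality of the Krein extension\<close>

context sqrt_pair
begin

text \<open>This is \<open>fried_core\<close> for the inverse relation; the sum \<open>u + w\<close>
  does not change when the pair is swapped.\<close>

lemma krein_core:
  assumes V: "nonneg_sym V" and T: "T = (fried (V\<inverse>))\<inverse>"
  shows "E x \<in> closure ((\<lambda>(u, w). E (u + w)) ` V)"
proof -
  interpret conv: sqrt_pair "T\<inverse>" E C by (rule sqrt_pair_converse)
  have "E x \<in> closure ((\<lambda>(u, w). E (u + w)) ` (V\<inverse>))"
    by (rule conv.fried_core) (use nonneg_sym_converse[OF V] T in auto)
  moreover have "(\<lambda>(u, w). E (u + w)) ` (V\<inverse>) = (\<lambda>(u, w). E (u + w)) ` V"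
  proof -
    have "V\<inverse> = (\<lambda>(u, w). (w, u)) ` V" by auto
    then show ?thesis by (simp add: image_image split_beta add.commute)
  qed
  ultimately show ?thesis by simp
qed

lemma krein_extends:
  assumes V: "nonneg_sym V" and T: "T = (fried (V\<inverse>))\<inverse>"
  shows "V \<subseteq> T"
  using fried_extends[OF nonneg_sym_converse[OF V]] T by auto

text \<open>Since \<open>u = C (C (u + w))\<close>, the root maps \<open>u\<close> to
  \<open>C (E (u + w))\<close>. Applying \<open>C\<close> to the approximation in
  \<open>krein_core\<close> reaches \<open>E (C y)\<close>, and density of the range of
  \<open>C\<close> gives all of \<open>E x\<close>.\<close>

lemma krein_range:
  assumes V: "nonneg_sym V" and T: "T = (fried (V\<inverse>))\<inverse>"
    and dense: "closure (range C) = UNIV"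
  shows "E x \<in> closure {s. \<exists>u w. (u, w) \<in> V \<and> (u, s) \<in> S}"
proof -
  let ?D = "{s. \<exists>u w. (u, w) \<in> V \<and> (u, s) \<in> S}"
  let ?R = "(\<lambda>(u, w). E (u + w)) ` V"
  have "(u, C (E (u + w))) \<in> S" if "(u, w) \<in> V" for u w
    using memS[of "C (u + w)"] T_resolvent[of u w] krein_extends[OF V T] that by (auto simp: CE)
  then have "blinfun_apply C ` ?R \<subseteq> ?D" by auto
  then have *: "closure (blinfun_apply C ` ?R) \<subseteq> closure ?D" by (rule closure_mono)
  have "E (C y) \<in> closure ?D" for y
    using blinfun_image_closure[OF krein_core[OF V T], of C y] * by (auto simp: CE)
  then have "closure (blinfun_apply E ` range C) \<subseteq> closure ?D"
    by (intro closure_minimal) auto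
  moreover have "E x \<in> closure (blinfun_apply E ` range C)"
    by (rule blinfun_image_closure) (simp add: dense)
  ultimately show ?thesis by blast
qed

lemma energy:
  assumes "(u, w) \<in> T"
  shows "(u, E (C (u + w))) \<in> S" "(norm (E (C (u + w))))\<^sup>2 = u \<bullet> w"
proof -
  note r = T_resolvent[OF assms]
  show "(u, E (C (u + w))) \<in> S" using memS[of "C (u + w)"] r by simp
  have "(norm (E (C (u + w))))\<^sup>2 = C (C (u + w)) \<bullet> E (E (u + w))"
    by (simp add: power2_norm_eq_inner symC symE CE)
  then show "(norm (E (C (u + w))))\<^sup>2 = u \<bullet> w" using r by simp
qed

text \<open>The functional \<open>t \<mapsto> \<langle>f, E\<^sup>2 t\<rangle>\<close> is bounded by \<open>\<parallel>C E t\<parallel>\<close>, and representing it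
  by a vector \<open>z\<close> in the closure of the range of \<open>C E\<close> gives \<open>E f = C z\<close>.\<close>

lemma S_mem_bounded:
  assumes M: "0 \<le> M" and bound: "\<And>t. \<bar>f \<bullet> E (E t)\<bar> \<le> M * norm (C (E t))"
  shows "\<exists>z. (f, z) \<in> S \<and> norm z \<le> M"
proof -
  define a where "a t t' = C (E t) \<bullet> C (E t')" for t t'
  have "bilinear a"
    by (auto simp: a_def bilinear_def blinfun.add_right blinfun.scaleR_right inner_add_left inner_add_right
        intro!: linearI)
  moreover have "linear (\<lambda>t. f \<bullet> E (E t))"
    by (auto simp: blinfun.add_right blinfun.scaleR_right inner_add_right intro!: linearI)
  moreover have "(f \<bullet> E (E t))\<^sup>2 \<le> M\<^sup>2 * a t t" for t
    using power_mono[OF bound[of t], of 2] by (simp add: a_def power_mult_distrib power2_norm_eq_inner)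
  ultimately obtain t where
    cau: "\<And>m n. a (t m - t n) (t m - t n) \<le> 2 / real (Suc m) + 2 / real (Suc n)"
    and lim: "\<And>y. (\<lambda>n. a (t n) y) \<longlonglongrightarrow> f \<bullet> E (E y)"
    using approx_riesz[OF subspace_UNIV, of a "\<lambda>t. f \<bullet> E (E t)" "M\<^sup>2"]
    by (auto simp: a_def inner_commute)
  define r where "r n = C (E (t n))" for n
  have "a (t m - t n) (t m - t n) = (norm (r m - r n))\<^sup>2" for m n
    by (simp add: r_def a_def power2_norm_eq_inner blinfun.diff_right)
  then have "Cauchy r"
    using reciprocal_bound_small[OF cau] by (intro CauchyI_power2) simp
  then obtain z where z: "r \<longlonglongrightarrow> z" using Cauchy_convergent convergent_def by blast
  have zy: "z \<bullet> C (E y) = f \<bullet> E (E y)" for y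
  proof -
    have "(\<lambda>n. r n \<bullet> C (E y)) \<longlonglongrightarrow> z \<bullet> C (E y)" by (intro tendsto_intros z)
    then show ?thesis using lim[of y] LIMSEQ_unique unfolding a_def r_def by blast
  qed
  have "(norm z)\<^sup>2 \<le> M * norm z"
  proof (rule LIMSEQ_le)
    show "(\<lambda>n. z \<bullet> r n) \<longlonglongrightarrow> (norm z)\<^sup>2" unfolding power2_norm_eq_inner by (intro tendsto_intros z)
    show "(\<lambda>n. M * norm (r n)) \<longlonglongrightarrow> M * norm z" by (intro tendsto_intros z)
    have "z \<bullet> r n \<le> M * norm (r n)" for n
      using bound[of "t n"] zy[of "t n"] by (simp add: r_def)
    then show "\<exists>N. \<forall>n\<ge>N. z \<bullet> r n \<le> M * norm (r n)" by blast
  qed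
  then have "norm z \<le> M" using M by (cases "norm z = 0") (auto simp: power2_eq_square)
  \<comment> \<open>The difference lies in the closed range of \<open>E\<close> and, by the
    representation of the functional, in its kernel.\<close>
  moreover have "C z - E f = 0"
  proof (rule pos_bl_range_ker[OF posE])
    have "C (r n) - E f = E (C (C (t n)) - f)" for n by (simp add: r_def blinfun.diff_right CE)
    moreover have "(\<lambda>n. C (r n) - E f) \<longlonglongrightarrow> C z - E f"
      by (intro tendsto_intros blinfun.tendsto z)
    ultimately show "C z - E f \<in> closure (range E)" unfolding closure_sequential by (metis rangeI)
    have "y \<bullet> (E (C z) - E (E f)) = 0" for y
      using zy[of y] by (simp add: inner_diff_right symC symE CE inner_commute[of z] inner_commute[of f])
    then show "E (C z - E f) = 0" by (metis blinfun.diff_right inner_eq_zero_iff)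
  qed
  ultimately show ?thesis by (intro exI[of _ z]) (simp add: S_iff)
qed

text \<open>On \<open>V\<close>, \<open>w\<close> is the square of the root of \<open>T'\<close>
  applied to \<open>u\<close>, so \<open>f \<bullet> w\<close> is the product of \<open>q\<close>
  with a vector whose squared norm is \<open>u \<bullet> w\<close>. The Krein root gives
  \<open>u\<close> the same energy, which is the bound needed in \<open>S_mem_bounded\<close> on a
  dense set.\<close>

lemma krein_minimal:
  assumes V: "nonneg_sym V" and T: "T = (fried (V\<inverse>))\<inverse>"
    and R: "sqrt_pair T' C' E'" "V \<subseteq> T'" and fq: "(f, q) \<in> sqrt_pair.S C' E'"
  shows "\<exists>z. (f, z) \<in> S \<and> norm z \<le> norm q"
proof (rule S_mem_bounded)
  interpret R: sqrt_pair T' C' E' by (rule R(1))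
  have VT: "V \<subseteq> T" by (rule krein_extends[OF V T])
  \<comment> \<open>The estimate is a closed condition on \<open>y = E t\<close>, so
    \<open>krein_core\<close> extends it from pairs of \<open>V\<close> to all
    \<open>t\<close>.\<close>
  let ?A = "{y. \<bar>f \<bullet> E y\<bar> \<le> norm q * norm (C y)}"
  have cl: "closed ?A"
    by (intro closed_Collect_le continuous_intros blinfun.continuous_on)
  have "(\<lambda>(u, w). E (u + w)) ` V \<subseteq> ?A"
  proof safe
    fix u w assume uw: "(u, w) \<in> V"
    let ?s = "E' (C' (u + w))"
    have uwT: "(u, w) \<in> T" "(u, w) \<in> T'" using VT R(2) uw by auto
    have w: "w = E (E (u + w))" using T_resolvent uwT by metis
    have "E' ?s = C' (E' (E' (u + w)))" by (simp add: R.CE)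
    then have "(?s, w) \<in> R.S" using R.T_resolvent[OF uwT(2)] by (simp add: R.S_iff)
    then have "w \<bullet> f = ?s \<bullet> q"
      using R.nonneg_sa_S fq radjD[of f q R.S] by (simp add: nonneg_sa_def)
    then have "\<bar>f \<bullet> w\<bar> \<le> norm ?s * norm q"
      using Cauchy_Schwarz_ineq2[of ?s q] by (simp add: inner_commute)
    moreover have "norm ?s = norm (C (E (u + w)))"
      using energy(2)[OF uwT(1)] R.energy(2)[OF uwT(2)]
      by (metis CE norm_ge_zero power2_eq_imp_eq)
    ultimately show "\<bar>f \<bullet> E (E (u + w))\<bar> \<le> norm q * norm (C (E (u + w)))"
      using w by (simp add: mult.commute)
  qed
  then show "\<bar>f \<bullet> E (E t)\<bar> \<le> norm q * norm (C (E t))" for t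
    using closure_minimal[OF _ cl] krein_core[OF V T, of t] by blast
qed simp

end

section \<open>Complex Hilbert spaces\<close>

lemma scaleC_zero_right [simp]: "c *\<^sub>C (0 :: 'a::complex_inner) = 0"
  using scaleC_add_right[of c 0 "0 :: 'a"] by simp

lemma scaleC_minus_right [simp]: "c *\<^sub>C (- x) = - (c *\<^sub>C (x :: 'a::complex_inner))"
  using scaleC_add_right[of c x "- x"] by (simp add: eq_neg_iff_add_eq_0 add.commute)

lemma scaleC_diff_right: "c *\<^sub>C (x - y) = c *\<^sub>C x - c *\<^sub>C (y :: 'a::complex_inner)"
  using scaleC_add_right[of c x "- y"] by simp

lemma scaleC_minus_one [simp]: "(- 1) *\<^sub>C x = - (x :: 'a::complex_inner)"
  using scaleR_scaleC[of "- 1" x] by simp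

lemma cinner_add_left: "cinner (x + y) (z :: 'a::complex_inner) = cinner x z + cinner y z"
  by (metis cinner_add_right cinner_commute complex_cnj_add)

lemma cinner_scaleC_left: "cinner (c *\<^sub>C x) (y :: 'a::complex_inner) = cnj c * cinner x y"
  by (metis cinner_commute cinner_scaleC_right complex_cnj_mult)

lemma cinner_diff_right: "cinner x (y - z :: 'a::complex_inner) = cinner x y - cinner x z"
  using cinner_add_right[of x "y - z" z] by simp

lemma cinner_diff_left: "cinner (x - y) (z :: 'a::complex_inner) = cinner x z - cinner y z"
  using cinner_add_left[of "x - y" y z] by simp

lemma Im_cinner: "Im (cinner x (y :: 'a::complex_inner)) = (\<i> *\<^sub>C x) \<bullet> y"
  by (simp add: cinner_scaleC_left flip: Re_cinner)

lemma inner_i_i [simp]: "(\<i> *\<^sub>C x) \<bullet> (\<i> *\<^sub>C y) = x \<bullet> (y :: 'a::complex_inner)"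
  by (simp add: cinner_scaleC_left cinner_scaleC_right flip: Re_cinner)

lemma inner_i_left: "(\<i> *\<^sub>C x) \<bullet> y = - (x \<bullet> (\<i> *\<^sub>C (y :: 'a::complex_inner)))"
  by (simp add: cinner_scaleC_left cinner_scaleC_right flip: Re_cinner)

lemma norm_scaleC: "norm (c *\<^sub>C (x :: 'a::complex_inner)) = cmod c * norm x"
proof -
  have "(norm (c *\<^sub>C x))\<^sup>2 = Re (cnj c * c * cinner x x)"
    unfolding power2_norm_eq_inner by (simp add: cinner_scaleC_left cinner_scaleC_right algebra_simps flip: Re_cinner)
  also have "cnj c * c = complex_of_real ((cmod c)\<^sup>2)" by (simp only: complex_norm_square mult.commute)
  also have "Re (complex_of_real ((cmod c)\<^sup>2) * cinner x x) = (cmod c * norm x)\<^sup>2"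
    by (simp add: Re_cinner power2_norm_eq_inner power_mult_distrib)
  finally show ?thesis by (simp add: power2_eq_iff_nonneg)
qed

lemma scaleC_decompose:
  "c *\<^sub>C x = Re c *\<^sub>R x + Im c *\<^sub>R (\<i> *\<^sub>C (x :: 'a::complex_inner))"
proof -
  have "c = complex_of_real (Re c) + complex_of_real (Im c) * \<i>" by (simp add: complex_eq_iff)
  then show ?thesis by (metis scaleC_add_left scaleC_scaleC scaleR_scaleC)
qed

lemma bounded_linear_scaleC: "bounded_linear (\<lambda>x :: 'a::complex_inner. c *\<^sub>C x)"
proof (rule bounded_linear_intro)
  show "c *\<^sub>C (r *\<^sub>R x) = r *\<^sub>R (c *\<^sub>C x)" for r and x :: 'a
    by (simp add: scaleR_scaleC scaleC_scaleC mult.commute)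
  show "norm (c *\<^sub>C x) \<le> norm x * cmod c" for x :: 'a by (simp add: norm_scaleC mult.commute)
qed (rule scaleC_add_right)

section \<open>Complex linearity as invariance under the imaginary unit\<close>

definition i_inv :: "('a::complex_inner \<times> 'a) set \<Rightarrow> bool" where
  "i_inv G \<longleftrightarrow> (\<forall>(x, y)\<in>G. (\<i> *\<^sub>C x, \<i> *\<^sub>C y) \<in> G)"

lemma i_invD: "i_inv G \<Longrightarrow> (x, y) \<in> G \<Longrightarrow> (\<i> *\<^sub>C x, \<i> *\<^sub>C y) \<in> G"
  by (auto simp: i_inv_def)

lemma i_inv_converse: "i_inv G \<Longrightarrow> i_inv (G\<inverse>)"
  by (auto simp: i_inv_def)

text \<open>The real and imaginary parts of the complex adjoint identity at \<open>(x, w)\<close>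
  are the real identities at \<open>(x, w)\<close> and at its multiple by
  \<open>\<i>\<close>.\<close>

lemma adjoint_eq_radj: "i_inv G \<Longrightarrow> adjoint G = radj G"
proof safe
  fix y z assume "(y, z) \<in> adjoint G"
  then show "(y, z) \<in> radj G" by (intro radjI) (force simp: adjoint_def simp flip: Re_cinner)
next
  fix y z assume G: "i_inv G" and *: "(y, z) \<in> radj G"
  have "cinner w y = cinner x z" if "(x, w) \<in> G" for x w
    using radjD[OF * that] radjD[OF * i_invD[OF G that]] by (simp add: complex_eq_iff Re_cinner Im_cinner)
  then show "(y, z) \<in> adjoint G" by (auto simp: adjoint_def)
qed

lemma i_inv_radj: "i_inv G \<Longrightarrow> i_inv (radj G)"
  unfolding adjoint_eq_radj[symmetric] by (auto simp: i_inv_def adjoint_def cinner_scaleC_right)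

lemma is_operator_subspace: "is_operator G \<Longrightarrow> subspace G"
  by (intro subspaceI) (auto simp: is_operator_def zero_prod_def scaleR_scaleC split_beta)

lemma is_operator_i_inv: "is_operator G \<Longrightarrow> i_inv G"
  by (auto simp: is_operator_def i_inv_def)

lemma is_operator_add: "is_operator G \<Longrightarrow> (x, y) \<in> G \<Longrightarrow> (x', y') \<in> G \<Longrightarrow> (x + x', y + y') \<in> G"
  and is_operator_scaleC: "is_operator G \<Longrightarrow> (x, y) \<in> G \<Longrightarrow> (c *\<^sub>C x, c *\<^sub>C y) \<in> G"
  and is_operator_zero: "is_operator G \<Longrightarrow> (0, 0) \<in> G"
  by (simp_all add: is_operator_def)

lemma is_operatorI:
  assumes "subspace G" "i_inv G" "\<And>y. (0, y) \<in> G \<Longrightarrow> y = 0"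
  shows "is_operator G"
  unfolding is_operator_def
proof (intro conjI allI impI)
  show "(0, 0) \<in> G" using subspace_0[OF assms(1)] by (simp add: zero_prod_def)
  show "(x + x', y + y') \<in> G" if "(x, y) \<in> G" "(x', y') \<in> G" for x y x' y'
    using subspace_add[OF assms(1) that] by simp
  show "(c *\<^sub>C x, c *\<^sub>C y) \<in> G" if "(x, y) \<in> G" for c x y
  proof -
    have "Re c *\<^sub>R (x, y) + Im c *\<^sub>R (\<i> *\<^sub>C x, \<i> *\<^sub>C y) \<in> G"
      by (intro subspace_add subspace_mul assms(1) that i_invD[OF assms(2)])
    then show ?thesis unfolding scaleC_decompose[of c x] scaleC_decompose[of c y] by simp
  qed
qed (use assms(3) in blast)

lemma is_operator_unique:
  assumes G: "is_operator G" and "(x, y) \<in> G" "(x, z) \<in> G"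
  shows "y = z"
proof -
  have "(x - x, y - z) \<in> G" using subspace_diff[OF is_operator_subspace[OF G] assms(2,3)] by simp
  then have "y - z = 0" using G by (auto simp: is_operator_def)
  then show ?thesis by simp
qed

lemma app_eq: "is_operator G \<Longrightarrow> (x, y) \<in> G \<Longrightarrow> app G x = y"
  unfolding app_def using is_operator_unique by blast

lemma app_mem: "is_operator G \<Longrightarrow> x \<in> dom_op G \<Longrightarrow> (x, app G x) \<in> G"
  by (auto simp: dom_op_def app_eq)

lemma radj_single_valued:
  assumes "closure (dom_op G) = UNIV" and "(0, y) \<in> radj G"
  shows "y = 0"
proof -
  obtain r where r: "r \<longlonglongrightarrow> y" "\<And>n. r n \<in> dom_op G"
    using assms(1) unfolding closure_sequential by (metis UNIV_I closure_sequential)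
  have "r n \<bullet> y = 0" for n
    using r(2)[of n] radjD[OF assms(2)] by (force simp: dom_op_def)
  moreover have "(\<lambda>n. r n \<bullet> y) \<longlonglongrightarrow> y \<bullet> y" by (intro tendsto_intros r)
  ultimately show ?thesis by (simp add: LIMSEQ_const_iff)
qed

lemma nonneg_selfadjointD:
  assumes "nonneg_selfadjoint T"
  shows "is_operator T" "closure (dom_op T) = UNIV" "nonneg_sa T" "i_inv T"
proof -
  show op: "is_operator T" and "closure (dom_op T) = UNIV"
    using assms by (auto simp: nonneg_selfadjoint_def selfadjoint_def densely_defined_def)
  show i: "i_inv T" by (rule is_operator_i_inv[OF op])
  show "nonneg_sa T"
    using assms is_operator_subspace[OF op] adjoint_eq_radj[OF i]
    by (auto simp: nonneg_sa_def nonneg_selfadjoint_def selfadjoint_def nonneg_op_def simp flip: Re_cinner)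
qed

lemma nonneg_selfadjointI:
  assumes "nonneg_sa T" "i_inv T" "closure (dom_op T) = UNIV"
  shows "nonneg_selfadjoint T"
proof -
  have T: "subspace T" "radj T = T" using assms by (auto simp: nonneg_sa_def)
  have "is_operator T"
    by (rule is_operatorI[OF T(1) assms(2)]) (use radj_single_valued[OF assms(3)] T(2) in blast)
  moreover have "Im (cinner x y) = 0" if "(x, y) \<in> T" for x y
  proof -
    \<comment> \<open>Real symmetry against the rotated pair and skewness of multiplication by
      \<open>\<i>\<close> give this number opposite signs, so the form is real.\<close>
    have "(\<i> *\<^sub>C y) \<bullet> x = (\<i> *\<^sub>C x) \<bullet> y"
      using radjD[of x y T, OF _ i_invD[OF assms(2) that]] T(2) that by simp
    moreover have "(\<i> *\<^sub>C y) \<bullet> x = - ((\<i> *\<^sub>C x) \<bullet> y)"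
      using inner_i_left[of x y] inner_commute[of "\<i> *\<^sub>C y" x] by simp
    ultimately show ?thesis by (simp add: Im_cinner)
  qed
  ultimately show ?thesis
    using assms adjoint_eq_radj[OF assms(2)] T(2)
    by (auto simp: nonneg_selfadjoint_def selfadjoint_def densely_defined_def nonneg_op_def
        nonneg_sa_def Re_cinner)
qed

text \<open>Multiplication by \<open>\<i>\<close> preserves \<open>T\<close>, hence commutes with
  \<open>C\<close> and \<open>E\<close>, which makes the real root complex linear. With
  \<open>S_unique\<close> this identifies the vector relation \<open>S\<close> with the operator
  described by \<open>op_sqrt\<close>.\<close>

lemma sqrt_pair_op_sqrt:
  fixes T :: "'a::chilbert_space op"
  assumes T: "nonneg_selfadjoint T" and p: "sqrt_pair T C E"
  shows "op_sqrt T = sqrt_pair.S C E" "nonneg_selfadjoint (sqrt_pair.S C E)"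
proof -
  interpret sqrt_pair T C E by (rule p)
  define J where "J = Blinfun (\<lambda>x :: 'a. \<i> *\<^sub>C x)"
  have J: "blinfun_apply J = (\<lambda>x. \<i> *\<^sub>C x)"
    unfolding J_def by (rule bounded_linear_Blinfun_apply[OF bounded_linear_scaleC])
  have "(\<forall>x. J (C x) = C (J x)) \<and> (\<forall>x. J (E x) = E (J x))"
    by (rule commute) (use nonneg_selfadjointD(4)[OF T] in \<open>auto simp: J i_inv_def\<close>)
  then have "i_inv S" by (auto simp: J i_inv_def S_iff) metis
  moreover have "closure (dom_op S) = UNIV"
  proof -
    have "dom_op T \<subseteq> dom_op S" unfolding comp_S[symmetric] by (force simp: dom_op_def comp_op_def)
    then show ?thesis using nonneg_selfadjointD(2)[OF T] closure_mono by blast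
  qed
  ultimately show S: "nonneg_selfadjoint S" using nonneg_sa_S by (intro nonneg_selfadjointI)
  show "op_sqrt T = S"
    unfolding op_sqrt_def using S comp_S S_unique nonneg_selfadjointD(3) by (intro the_equality) blast+
qed

lemma op_sqrt_works:
  fixes T :: "'a::chilbert_space op"
  assumes T: "nonneg_selfadjoint T"
  shows "nonneg_selfadjoint (op_sqrt T)" "comp_op (op_sqrt T) (op_sqrt T) = T"
proof -
  obtain C E where p: "sqrt_pair T C E" using nonneg_sa_sqrt_pair nonneg_selfadjointD(3)[OF T] by blast
  show "nonneg_selfadjoint (op_sqrt T)" "comp_op (op_sqrt T) (op_sqrt T) = T"
    using sqrt_pair_op_sqrt[OF T p] sqrt_pair.comp_S[OF p] by simp_all
qed

lemma form_le_iff: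
  fixes S T :: "'a::chilbert_space op"
  assumes "nonneg_selfadjoint S" "nonneg_selfadjoint T"
  shows "form_le S T \<longleftrightarrow> (\<forall>(f, q)\<in>op_sqrt T. \<exists>z. (f, z) \<in> op_sqrt S \<and> norm z \<le> norm q)"
proof -
  note op = nonneg_selfadjointD(1)[OF op_sqrt_works(1)[OF assms(1)]]
    nonneg_selfadjointD(1)[OF op_sqrt_works(1)[OF assms(2)]]
  have dom: "f \<in> dom_op G \<longleftrightarrow> (\<exists>y. (f, y) \<in> G)" for f and G :: "'a op"
    by (force simp: dom_op_def)
  show ?thesis
    unfolding form_le_def subset_iff dom Ball_def split_paired_All
    using app_eq[OF op(1)] app_eq[OF op(2)] by (auto; metis)
qed

lemma i_inv_fried: "i_inv U \<Longrightarrow> i_inv (fried (U :: 'a::complex_inner op))"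
  unfolding i_inv_def[of "fried U"]
proof safe
  fix f g assume U: "i_inv U" and "(f, g) \<in> fried U"
  then obtain p where p: "(f, g) \<in> radj U" "\<And>n. p n \<in> U" "(\<lambda>n. fst (p n)) \<longlonglongrightarrow> f" "form_Cauchy p"
    by (metis friedE)
  let ?p = "\<lambda>n. (\<i> *\<^sub>C fst (p n), \<i> *\<^sub>C snd (p n))"
  show "(\<i> *\<^sub>C f, \<i> *\<^sub>C g) \<in> fried U"
  proof (rule friedI[where p="?p"])
    show "(\<i> *\<^sub>C f, \<i> *\<^sub>C g) \<in> radj U" using i_invD[OF i_inv_radj[OF U] p(1)] .
    show "?p n \<in> U" for n using i_invD[OF U, of "fst (p n)" "snd (p n)"] p(2) by simp
    show "(\<lambda>n. fst (?p n)) \<longlonglongrightarrow> fst (\<i> *\<^sub>C f, \<i> *\<^sub>C g)"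
      using bounded_linear.tendsto[OF bounded_linear_scaleC p(3)] by simp
    show "form_Cauchy ?p" using p(4) by (simp add: form_Cauchy_def flip: scaleC_diff_right)
  qed
qed

section \<open>Friedrichs and Krein extensions of a densely defined operator\<close>

locale nonneg_symmetric =
  fixes V :: "'a::chilbert_space op"
  assumes op: "is_operator V" and sym: "nonneg_sym V" and dense: "closure (dom_op V) = UNIV"
begin

lemma friedrichs_eq: "friedrichs V = fried V"
proof -
  have eq: "f \<in> form_closure_dom V \<longleftrightarrow>
    (\<exists>p. (\<forall>n. p n \<in> V) \<and> (\<lambda>n. fst (p n)) \<longlonglongrightarrow> f \<and> form_Cauchy p)" for f
  proof
    assume "f \<in> form_closure_dom V"
    then obtain u where u: "\<And>n. u n \<in> dom_op V" "u \<longlonglongrightarrow> f"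
      "\<And>e. e > 0 \<Longrightarrow> \<exists>N. \<forall>m\<ge>N. \<forall>n\<ge>N. Re (cinner (u m - u n) (app V (u m - u n))) < e"
      by (auto simp: form_closure_dom_def)
    have V: "(u n, app V (u n)) \<in> V" for n by (rule app_mem[OF op u(1)])
    have "app V (u m - u n) = app V (u m) - app V (u n)" for m n
      using subspace_diff[OF is_operator_subspace[OF op] V V] by (intro app_eq[OF op]) simp
    then have "form_Cauchy (\<lambda>n. (u n, app V (u n)))"
      using u(3) by (simp add: form_Cauchy_def Re_cinner)
    then show "\<exists>p. (\<forall>n. p n \<in> V) \<and> (\<lambda>n. fst (p n)) \<longlonglongrightarrow> f \<and> form_Cauchy p"
      using V u(2) by (intro exI[of _ "\<lambda>n. (u n, app V (u n))"]) auto
  next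
    assume "\<exists>p. (\<forall>n. p n \<in> V) \<and> (\<lambda>n. fst (p n)) \<longlonglongrightarrow> f \<and> form_Cauchy p"
    then obtain p where p: "\<And>n. p n \<in> V" "(\<lambda>n. fst (p n)) \<longlonglongrightarrow> f" "form_Cauchy p" by blast
    have "(fst (p m) - fst (p n), snd (p m - p n)) = p m - p n" for m n by (simp add: prod_eq_iff)
    then have "app V (fst (p m) - fst (p n)) = snd (p m - p n)" for m n
      using subspace_diff[OF is_operator_subspace[OF op] p(1)[of m] p(1)[of n]]
      by (intro app_eq[OF op]) simp
    then show "f \<in> form_closure_dom V"
      unfolding form_closure_dom_def using p
      by (auto simp: form_Cauchy_def dom_op_def Re_cinner intro!: exI[of _ "\<lambda>n. fst (p n)"])
  qed
  show ?thesis
    unfolding friedrichs_def fried_def adjoint_eq_radj[OF is_operator_i_inv[OF op]] eq by blast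
qed

lemma friedrichs_selfadjoint: "nonneg_selfadjoint (fried V)"
proof (rule nonneg_selfadjointI)
  obtain C E where "sqrt_pair (fried V) C E"
    using sqrt_pair_exists[OF nonneg_sym_fried[OF sym]] fried_total[OF sym] by blast
  then show "nonneg_sa (fried V)" by (rule sqrt_pair.nonneg_sa_T)
  show "i_inv (fried V)" by (rule i_inv_fried[OF is_operator_i_inv[OF op]])
  have "dom_op V \<subseteq> dom_op (fried V)" using fried_extends[OF sym] by (force simp: dom_op_def)
  then show "closure (dom_op (fried V)) = UNIV" using dense closure_mono by blast
qed

definition "K = (fried (V\<inverse>))\<inverse>"

lemma krein_pair: obtains C E where "sqrt_pair K C E"
proof -
  have "nonneg_sym (V\<inverse>)" by (rule nonneg_sym_converse[OF sym])
  then obtain C E where "sqrt_pair (fried (V\<inverse>)) C E"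
    using sqrt_pair_exists[OF nonneg_sym_fried] fried_total by blast
  then have "sqrt_pair K E C" unfolding K_def by (rule sqrt_pair.sqrt_pair_converse)
  then show thesis by (rule that)
qed

lemma K_extends: "V \<subseteq> K"
  using krein_pair sqrt_pair.krein_extends[OF _ sym K_def] by metis

lemma K_selfadjoint: "nonneg_selfadjoint K"
proof (rule nonneg_selfadjointI)
  show "nonneg_sa K" using krein_pair sqrt_pair.nonneg_sa_T by metis
  show "i_inv K" unfolding K_def by (intro i_inv_converse i_inv_fried is_operator_i_inv[OF op])
  have "dom_op V \<subseteq> dom_op K" using K_extends by (force simp: dom_op_def)
  then show "closure (dom_op K) = UNIV" using dense closure_mono by blast
qed

lemma K_minimal:
  assumes T: "nonneg_selfadjoint T" "V \<subseteq> T" shows "form_le K T"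
proof -
  obtain C E where p: "sqrt_pair K C E" by (rule krein_pair)
  obtain C' E' where q: "sqrt_pair T C' E'"
    using nonneg_sa_sqrt_pair nonneg_selfadjointD(3)[OF T(1)] by blast
  show ?thesis
    unfolding form_le_iff[OF K_selfadjoint T(1)] sqrt_pair_op_sqrt(1)[OF K_selfadjoint p]
      sqrt_pair_op_sqrt(1)[OF T(1) q]
    using sqrt_pair.krein_minimal[OF p sym K_def q T(2)] by blast
qed

text \<open>Two least extensions dominate each other, so their square roots have the same domain and
  the same norms; \<open>comp_op_determined\<close> then identifies their squares.\<close>

lemma krein_eq: "krein V = K"
  unfolding krein_def
proof (rule the_equality)
  show "nonneg_selfadjoint K \<and> V \<subseteq> K \<and> (\<forall>T. nonneg_selfadjoint T \<and> V \<subseteq> T \<longrightarrow> form_le K T)"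
    using K_selfadjoint K_extends K_minimal by blast
  fix K' assume K': "nonneg_selfadjoint K' \<and> V \<subseteq> K' \<and>
    (\<forall>T. nonneg_selfadjoint T \<and> V \<subseteq> T \<longrightarrow> form_le K' T)"
  then have sa: "nonneg_selfadjoint K'" by blast
  have "form_le K K'" "form_le K' K" using K' K_selfadjoint K_extends K_minimal by blast+
  then have le: "\<And>f q. (f, q) \<in> op_sqrt K' \<Longrightarrow> \<exists>z. (f, z) \<in> op_sqrt K \<and> norm z \<le> norm q"
    "\<And>f q. (f, q) \<in> op_sqrt K \<Longrightarrow> \<exists>z. (f, z) \<in> op_sqrt K' \<and> norm z \<le> norm q"
    unfolding form_le_iff[OF K_selfadjoint sa] form_le_iff[OF sa K_selfadjoint] by blast+
  note s = op_sqrt_works[OF K_selfadjoint] op_sqrt_works[OF sa]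
  have dom: "dom_op (op_sqrt K) = dom_op (op_sqrt K')" using le by (force simp: dom_op_def image_iff)
  have norm: "norm z = norm z'" if "(f, z) \<in> op_sqrt K" "(f, z') \<in> op_sqrt K'" for f z z'
    using le(1)[OF that(2)] le(2)[OF that(1)] is_operator_unique nonneg_selfadjointD(1) s that
    by (metis order_antisym)
  note sa' = nonneg_selfadjointD(3)[OF s(1)] nonneg_selfadjointD(3)[OF s(3)]
  have "comp_op (op_sqrt K) (op_sqrt K) \<subseteq> comp_op (op_sqrt K') (op_sqrt K')"
    by (rule comp_op_determined[OF sa' dom norm])
  moreover have "comp_op (op_sqrt K') (op_sqrt K') \<subseteq> comp_op (op_sqrt K) (op_sqrt K)"
    by (rule comp_op_determined[OF sa'(2,1) dom[symmetric] norm[symmetric]])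
  ultimately show "K' = K" using s(2,4) by simp
qed

end

section \<open>The partial isometry\<close>

lemma csubspace_scaleC: "csubspace S \<Longrightarrow> x \<in> S \<Longrightarrow> c *\<^sub>C x \<in> S"
  by (simp add: csubspace_def)

lemma csubspace_imp_subspace: "csubspace S \<Longrightarrow> subspace S"
  by (auto simp: csubspace_def subspace_def scaleR_scaleC)

lemma csubspace_closure:
  assumes S: "csubspace S" shows "csubspace (closure S)"
  unfolding csubspace_def
proof (intro conjI ballI allI)
  show "0 \<in> closure S" using S closure_subset by (auto simp: csubspace_def)
next
  fix x y assume "x \<in> closure S" "y \<in> closure S"
  then obtain a b where "\<And>n. a n \<in> S" "a \<longlonglongrightarrow> x" "\<And>n. b n \<in> S" "b \<longlonglongrightarrow> y"
    by (metis closure_sequential)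
  then have "\<And>n. a n + b n \<in> S" "(\<lambda>n. a n + b n) \<longlonglongrightarrow> x + y"
    using S by (auto simp: csubspace_def intro: tendsto_add)
  then show "x + y \<in> closure S" unfolding closure_sequential by (intro exI[of _ "\<lambda>n. a n + b n"]) simp
next
  fix c x assume "x \<in> closure S"
  then obtain a where "\<And>n. a n \<in> S" "a \<longlonglongrightarrow> x" by (metis closure_sequential)
  then have "\<And>n. c *\<^sub>C a n \<in> S" "(\<lambda>n. c *\<^sub>C a n) \<longlonglongrightarrow> c *\<^sub>C x"
    using S by (auto simp: csubspace_def intro: bounded_linear.tendsto[OF bounded_linear_scaleC])
  then show "c *\<^sub>C x \<in> closure S" unfolding closure_sequential by (intro exI[of _ "\<lambda>n. c *\<^sub>C a n"]) simp
qed

lemma mem_ran_op: "y \<in> ran_op G \<longleftrightarrow> (\<exists>x. (x, y) \<in> G)"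
  by (force simp: ran_op_def)

lemma csubspace_ran_op: "is_operator G \<Longrightarrow> csubspace (ran_op G)"
  unfolding csubspace_def Ball_def mem_ran_op is_operator_def by blast

lemma csubspace_ker_op: "is_operator G \<Longrightarrow> csubspace (ker_op G)"
  unfolding csubspace_def ker_op_def is_operator_def Ball_def mem_Collect_eq
  by (metis add_0 scaleC_zero_right)

text \<open>Minimising with the inner product as form and \<open>x\<close> as functional: the Riesz
  representative of \<open>x\<close> on \<open>M\<close> is its projection.\<close>

lemma hilbert_projection:
  fixes M :: "'a::{real_inner,banach} set"
  assumes M: "subspace M" "closed M"
  obtains p where "p \<in> M" "\<And>m. m \<in> M \<Longrightarrow> (x - p) \<bullet> m = 0"
proof -
  have bil: "bilinear (\<lambda>x y :: 'a. x \<bullet> y)"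
    by (auto simp: bilinear_def inner_add_left inner_add_right intro!: linearI)
  have lin: "linear (\<lambda>m. x \<bullet> m)" by (auto simp: inner_add_right intro!: linearI)
  have "(x \<bullet> m)\<^sup>2 \<le> (norm x)\<^sup>2 * (m \<bullet> m)" for m
    using Cauchy_Schwarz_ineq[of x m] by (simp add: power2_norm_eq_inner)
  then obtain u where u: "\<And>n. u n \<in> M"
    and c: "\<And>m n. (u m - u n) \<bullet> (u m - u n) \<le> 2 / real (Suc m) + 2 / real (Suc n)"
    and l: "\<And>y. y \<in> M \<Longrightarrow> (\<lambda>n. u n \<bullet> y) \<longlonglongrightarrow> x \<bullet> y"
    using approx_riesz[OF M(1) bil inner_commute inner_ge_zero lin zero_le_power2] by blast
  have "Cauchy u"
    by (rule CauchyI_power2) (use reciprocal_bound_small[OF c] in \<open>simp add: power2_norm_eq_inner\<close>)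
  then obtain p where p: "u \<longlonglongrightarrow> p" using Cauchy_convergent convergent_def by blast
  show thesis
  proof (rule that)
    show "p \<in> M" using closed_sequentially[OF M(2)] u p by blast
    fix m assume "m \<in> M"
    then have "(\<lambda>n. u n \<bullet> m) \<longlonglongrightarrow> x \<bullet> m" by (rule l)
    moreover have "(\<lambda>n. u n \<bullet> m) \<longlonglongrightarrow> p \<bullet> m" by (intro tendsto_intros p)
    ultimately show "(x - p) \<bullet> m = 0" using LIMSEQ_unique by (simp add: inner_diff_left) blast
  qed
qed

lemma ran_ker_orthogonal:
  assumes S: "nonneg_selfadjoint S" and r: "r \<in> closure (ran_op S)" and k: "k \<in> ker_op S"
  shows "r \<bullet> k = 0"
proof -
  have "(k, 0) \<in> radj S" using nonneg_selfadjointD(3)[OF S] k by (simp add: nonneg_sa_def ker_op_def)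
  then have "ran_op S \<subseteq> {r. r \<bullet> k = 0}" by (auto simp: ran_op_def dest: radjD)
  moreover have "closed {r. r \<bullet> k = 0}" by (intro closed_Collect_eq continuous_intros)
  ultimately show ?thesis using r closure_minimal by blast
qed

text \<open>The part of \<open>x\<close> orthogonal to the range satisfies the adjoint identity with
  value 0, and selfadjointness puts it into the kernel.\<close>

lemma ran_ker_decompose:
  fixes S :: "'a::chilbert_space op"
  assumes S: "nonneg_selfadjoint S"
  obtains p k where "p \<in> closure (ran_op S)" "k \<in> ker_op S" "x = p + k"
proof -
  have "subspace (closure (ran_op S))"
    by (intro csubspace_imp_subspace csubspace_closure csubspace_ran_op nonneg_selfadjointD(1)[OF S])
  then obtain p where p: "p \<in> closure (ran_op S)" "\<And>m. m \<in> closure (ran_op S) \<Longrightarrow> (x - p) \<bullet> m = 0"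
    using hilbert_projection[of _ x] by blast
  have "s \<in> closure (ran_op S)" if "(h, s) \<in> S" for h s
    using that closure_subset[of "ran_op S"] by (force simp: ran_op_def)
  then have "(x - p, 0) \<in> radj S" using p(2) by (intro radjI) (simp add: inner_commute)
  then have "x - p \<in> ker_op S" using nonneg_selfadjointD(3)[OF S] by (simp add: nonneg_sa_def ker_op_def)
  then show thesis using that[of p "x - p"] p(1) by simp
qed

text \<open>The condition under the description operator in \<open>part_iso\<close>, with the two
  square roots as parameters, so that existence and uniqueness can be treated separately.\<close>

definition is_part_iso :: "'a::complex_inner op \<Rightarrow> 'a op \<Rightarrow> ('a \<Rightarrow> 'a) \<Rightarrow> bool" where
  "is_part_iso SF SK U \<longleftrightarrow> clinear_fun U
     \<and> (\<forall>h\<in>dom_op SF. app SK h = U (app SF h))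
     \<and> (\<forall>x\<in>closure (ran_op SF). norm (U x) = norm x)
     \<and> (\<forall>x\<in>ker_op SF. U x = 0)
     \<and> range U \<subseteq> closure (ran_op SK)"

text \<open>The intertwining relation fixes the map on the range, isometry extends this to the
  closure, and on the complementary kernel the map is zero.\<close>

lemma is_part_iso_unique:
  fixes SF :: "'a::chilbert_space op"
  assumes SF: "nonneg_selfadjoint SF" and U: "is_part_iso SF SK U" and U': "is_part_iso SF SK U'"
  shows "U = U'"
proof
  fix x
  obtain p k where x: "p \<in> closure (ran_op SF)" "k \<in> ker_op SF" "x = p + k"
    using ran_ker_decompose[OF SF] by blast
  obtain s where s: "\<And>n. s n \<in> ran_op SF" "s \<longlonglongrightarrow> p" using x(1) by (metis closure_sequential)
  \<comment> \<open>Continuity along the closed range comes from the isometry condition applied to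
    \<open>s n - p\<close>.\<close>
  have lim: "(\<lambda>n. W (s n)) \<longlonglongrightarrow> W p" if W: "is_part_iso SF SK W" for W
  proof -
    have "csubspace (closure (ran_op SF))"
      by (intro csubspace_closure csubspace_ran_op nonneg_selfadjointD(1)[OF SF])
    then have "s n - p \<in> closure (ran_op SF)" for n
      using x(1) s(1) closure_subset by (metis csubspace_imp_subspace subset_iff subspace_diff)
    then have "norm (W (s n - p)) = norm (s n - p)" for n using W by (simp add: is_part_iso_def)
    moreover have "W (s n) = W (s n - p) + W p" for n
      using W unfolding is_part_iso_def clinear_fun_def by (metis diff_add_cancel)
    ultimately have "norm (W (s n) - W p) = norm (s n - p)" for n by simp
    moreover have "(\<lambda>n. norm (s n - p)) \<longlonglongrightarrow> 0" using s(2) by (simp add: LIM_zero tendsto_norm_zero)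
    ultimately have "(\<lambda>n. norm (W (s n) - W p)) \<longlonglongrightarrow> 0" by simp
    then show ?thesis by (rule LIM_zero_cancel[OF tendsto_norm_zero_cancel])
  qed
  have "W (s n) = app SK h" if "is_part_iso SF SK W" "(h, s n) \<in> SF" for W h n
  proof -
    have "h \<in> dom_op SF" using that(2) by (force simp: dom_op_def)
    then show ?thesis
      using that app_eq[OF nonneg_selfadjointD(1)[OF SF] that(2)] by (simp add: is_part_iso_def)
  qed
  moreover have "\<exists>h. (h, s n) \<in> SF" for n using s(1)[of n] by (auto simp: ran_op_def)
  ultimately have "U (s n) = U' (s n)" for n using U U' by metis
  then have "U p = U' p" using lim[OF U] lim[OF U'] LIMSEQ_unique by simp
  moreover have "W x = W p" if "is_part_iso SF SK W" for W
    using that x by (simp add: is_part_iso_def clinear_fun_def)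
  ultimately show "U x = U' x" using U U' by metis
qed

text \<open>The pairs \<open>(s, t)\<close> of values of the two roots at a common vector form an
  isometric linear relation. Its closure \<open>G\<close> has the closed range as domain, and
  \<open>U\<close> applies it after discarding the kernel component.\<close>

lemma is_part_iso_exists:
  fixes SF SK :: "'a::chilbert_space op"
  assumes SF: "nonneg_selfadjoint SF" and SK: "is_operator SK"
    and iso: "\<And>h s. (h, s) \<in> SF \<Longrightarrow> \<exists>t. (h, t) \<in> SK \<and> norm t = norm s"
  shows "\<exists>U. is_part_iso SF SK U"
proof -
  note opF = nonneg_selfadjointD(1)[OF SF]
  define G0 where "G0 = {(s, t). \<exists>h. (h, s) \<in> SF \<and> (h, t) \<in> SK}"
  define G where "G = closure G0"
  let ?R = "closure (ran_op SF)" and ?N = "ker_op SF"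
  have cR: "csubspace ?R" "csubspace ?N"
    by (intro csubspace_closure csubspace_ran_op csubspace_ker_op opF)+
  have add0: "(s + s', t + t') \<in> G0" if st: "(s, t) \<in> G0" "(s', t') \<in> G0" for s t s' t'
  proof -
    obtain h h' where "(h, s) \<in> SF" "(h, t) \<in> SK" "(h', s') \<in> SF" "(h', t') \<in> SK"
      using st by (auto simp: G0_def)
    then have "(h + h', s + s') \<in> SF" "(h + h', t + t') \<in> SK"
      using is_operator_add opF SK by blast+
    then show ?thesis by (auto simp: G0_def)
  qed
  have scale0: "(c *\<^sub>C s, c *\<^sub>C t) \<in> G0" if st: "(s, t) \<in> G0" for c s t
  proof -
    obtain h where "(h, s) \<in> SF" "(h, t) \<in> SK" using st by (auto simp: G0_def)
    then have "(c *\<^sub>C h, c *\<^sub>C s) \<in> SF" "(c *\<^sub>C h, c *\<^sub>C t) \<in> SK"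
      using is_operator_scaleC opF SK by blast+
    then show ?thesis by (auto simp: G0_def)
  qed
  have norm0: "norm s = norm t" if st: "(s, t) \<in> G0" for s t
  proof -
    obtain h where h: "(h, s) \<in> SF" "(h, t) \<in> SK" using st by (auto simp: G0_def)
    obtain t' where "(h, t') \<in> SK" "norm t' = norm s" using iso[OF h(1)] by blast
    then show ?thesis using is_operator_unique[OF SK h(2)] by force
  qed
  have seq: "\<exists>a b. (\<forall>n. (a n, b n) \<in> G0) \<and> a \<longlonglongrightarrow> s \<and> b \<longlonglongrightarrow> t" if st: "(s, t) \<in> G" for s t
  proof -
    obtain x where x: "\<And>n. x n \<in> G0" "x \<longlonglongrightarrow> (s, t)"
      using st unfolding G_def closure_sequential by blast
    show ?thesis
      using tendsto_fst[OF x(2)] tendsto_snd[OF x(2)] x(1)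
      by (intro exI[of _ "\<lambda>n. fst (x n)"] exI[of _ "\<lambda>n. snd (x n)"]) simp
  qed
  have memG: "(s, t) \<in> G" if "\<And>n. (a n, b n) \<in> G0" "a \<longlonglongrightarrow> s" "b \<longlonglongrightarrow> t" for a b s t
    unfolding G_def closure_sequential
    using that(1) tendsto_Pair[OF that(2,3)] by (intro exI[of _ "\<lambda>n. (a n, b n)"]) simp
  have addG: "(s + s', t + t') \<in> G" if st: "(s, t) \<in> G" "(s', t') \<in> G" for s t s' t'
  proof -
    obtain a b a' b' where "\<forall>n. (a n, b n) \<in> G0" "a \<longlonglongrightarrow> s" "b \<longlonglongrightarrow> t"
      "\<forall>n. (a' n, b' n) \<in> G0" "a' \<longlonglongrightarrow> s'" "b' \<longlonglongrightarrow> t'"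
      using seq[OF st(1)] seq[OF st(2)] by blast
    then show ?thesis
      by (intro memG[of "\<lambda>n. a n + a' n" "\<lambda>n. b n + b' n"]) (auto intro: add0 tendsto_add)
  qed
  have scaleG: "(c *\<^sub>C s, c *\<^sub>C t) \<in> G" if st: "(s, t) \<in> G" for c s t
  proof -
    obtain a b where "\<forall>n. (a n, b n) \<in> G0" "a \<longlonglongrightarrow> s" "b \<longlonglongrightarrow> t" using seq[OF st] by blast
    then show ?thesis
      by (intro memG[of "\<lambda>n. c *\<^sub>C a n" "\<lambda>n. c *\<^sub>C b n"])
        (auto intro: scale0 bounded_linear.tendsto[OF bounded_linear_scaleC])
  qed
  have normG: "norm s = norm t" if st: "(s, t) \<in> G" for s t
  proof -
    obtain a b where ab: "\<forall>n. (a n, b n) \<in> G0" "a \<longlonglongrightarrow> s" "b \<longlonglongrightarrow> t" using seq[OF st] by blast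
    then have "norm (a n) = norm (b n)" for n using norm0 by blast
    then show ?thesis using tendsto_norm[OF ab(2)] tendsto_norm[OF ab(3)] LIMSEQ_unique by simp
  qed
  have ranG: "s \<in> ?R" "t \<in> closure (ran_op SK)" if "(s, t) \<in> G" for s t
  proof -
    have "G0 \<subseteq> ran_op SF \<times> ran_op SK" by (force simp: G0_def ran_op_def)
    then have "G \<subseteq> ?R \<times> closure (ran_op SK)" unfolding G_def by (metis closure_mono closure_Times)
    then show "s \<in> ?R" "t \<in> closure (ran_op SK)" using that by auto
  qed
  have zeroG: "(0, 0) \<in> G"
    using closure_subset[of G0] is_operator_zero[OF opF] is_operator_zero[OF SK]
    unfolding G_def by (auto simp: G0_def)
  have totG: "\<exists>t. (p, t) \<in> G" if "p \<in> ?R" for p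
  proof -
    obtain s where s: "\<And>n. s n \<in> ran_op SF" "s \<longlonglongrightarrow> p" using \<open>p \<in> ?R\<close> by (metis closure_sequential)
    have "\<exists>t. (s n, t) \<in> G0" for n
      using s(1)[of n] iso unfolding G0_def ran_op_def by fastforce
    then obtain t where t: "\<And>n. (s n, t n) \<in> G0" by metis
    \<comment> \<open>Adding the pair with index \<open>m\<close> to minus the pair with index
      \<open>n\<close> transfers the Cauchy property from \<open>s\<close> to
      \<open>t\<close>.\<close>
    have d: "norm (t m - t n) = norm (s m - s n)" for m n
      using norm0[OF add0[OF t[of m] scale0[OF t[of n], of "-1"]]] by simp
    have "Cauchy s" using s(2) by (rule LIMSEQ_imp_Cauchy)
    then have "Cauchy t" unfolding Cauchy_iff d .
    then obtain y where "t \<longlonglongrightarrow> y" using Cauchy_convergent convergent_def by blast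
    then show ?thesis using memG[OF t s(2)] by blast
  qed
  have uniq: "y = y'" if "(p, y) \<in> G" "k \<in> ?N" "(p', y') \<in> G" "k' \<in> ?N" "p + k = p' + k'"
    for p y k p' y' k'
  proof -
    \<comment> \<open>The difference of the range parts lies also in the kernel, hence is orthogonal
      to itself; isometry of \<open>G\<close> then makes the values agree.\<close>
    have d: "p - p' = k' - k" using that(5) by (simp add: algebra_simps)
    have "p - p' \<in> ?R" using ranG(1) that(1,3) cR(1) by (simp add: csubspace_imp_subspace subspace_diff)
    moreover have "p - p' \<in> ?N" using that(2,4) cR(2) unfolding d by (simp add: csubspace_imp_subspace subspace_diff)
    ultimately have "p - p' = 0" using ran_ker_orthogonal[OF SF] inner_eq_zero_iff by blast
    moreover have "(p - p', y - y') \<in> G"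
      using addG[OF that(1) scaleG[OF that(3), of "-1"]] by simp
    ultimately have "norm (y - y') = 0" using normG by (metis norm_zero)
    then show ?thesis by simp
  qed
  have "\<exists>y p k. (p, y) \<in> G \<and> k \<in> ?N \<and> x = p + k" for x
    using ran_ker_decompose[OF SF, of x] totG by metis
  then obtain U where U: "\<And>x. \<exists>p k. (p, U x) \<in> G \<and> k \<in> ?N \<and> x = p + k" by metis
  have UI: "U (p + k) = y" if "(p, y) \<in> G" "k \<in> ?N" for p k y
    using U[of "p + k"] uniq that by metis
  have N0: "0 \<in> ?N" using cR(2) by (simp add: csubspace_def)
  have "clinear_fun U" unfolding clinear_fun_def
  proof (intro conjI allI)
    fix x y
    obtain p k p' k' where *: "(p, U x) \<in> G" "k \<in> ?N" "x = p + k" "(p', U y) \<in> G" "k' \<in> ?N" "y = p' + k'"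
      using U[of x] U[of y] by blast
    have "U ((p + p') + (k + k')) = U x + U y"
      by (rule UI[OF addG[OF *(1,4)]]) (use cR(2) * in \<open>auto simp: csubspace_def\<close>)
    then show "U (x + y) = U x + U y" using * by (simp add: algebra_simps)
  next
    fix c x
    obtain p k where *: "(p, U x) \<in> G" "k \<in> ?N" "x = p + k" using U[of x] by blast
    have "U (c *\<^sub>C p + c *\<^sub>C k) = c *\<^sub>C U x"
      by (rule UI[OF scaleG[OF *(1)] csubspace_scaleC[OF cR(2) *(2)]])
    then show "U (c *\<^sub>C x) = c *\<^sub>C U x" using * by (simp add: scaleC_add_right)
  qed
  moreover have "app SK h = U (app SF h)" if "h \<in> dom_op SF" for h
  proof -
    have s: "(h, app SF h) \<in> SF" by (rule app_mem[OF opF that])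
    then obtain t where t: "(h, t) \<in> SK" using iso by blast
    then have "(app SF h, t) \<in> G0" using s by (auto simp: G0_def)
    then have "(app SF h, t) \<in> G" using closure_subset unfolding G_def by blast
    then show ?thesis using UI[OF _ N0] app_eq[OF SK t] by force
  qed
  moreover have "norm (U x) = norm x" if x: "x \<in> ?R" for x
  proof -
    obtain t where t: "(x, t) \<in> G" using totG[OF x] by blast
    then show ?thesis using UI[OF t N0] normG[OF t] by simp
  qed
  moreover have "U x = 0" if "x \<in> ?N" for x using UI[OF zeroG that] by simp
  moreover have "U x \<in> closure (ran_op SK)" for x using U[of x] ranG(2) by blast
  ultimately have "is_part_iso SF SK U" unfolding is_part_iso_def by blast
  then show ?thesis by blast
qed

lemma part_iso_works:
  fixes T K :: "'a::chilbert_space op"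
  assumes "nonneg_selfadjoint (op_sqrt T)" "is_operator (op_sqrt K)"
    and "\<And>h s. (h, s) \<in> op_sqrt T \<Longrightarrow> \<exists>t. (h, t) \<in> op_sqrt K \<and> norm t = norm s"
  shows "is_part_iso (op_sqrt T) (op_sqrt K) (part_iso T K)"
proof -
  have "\<exists>!U. is_part_iso (op_sqrt T) (op_sqrt K) U"
    using is_part_iso_exists[OF assms] is_part_iso_unique[OF assms(1)] by blast
  then have "is_part_iso (op_sqrt T) (op_sqrt K) (THE U. is_part_iso (op_sqrt T) (op_sqrt K) U)"
    by (rule theI')
  then show ?thesis unfolding part_iso_def is_part_iso_def .
qed

text \<open>Polarising the norm identity gives the real part; replacing \<open>x\<close> by its
  multiple by \<open>\<i>\<close> gives the imaginary part.\<close>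

lemma is_part_iso_cinner:
  assumes SF: "is_operator SF" and U: "is_part_iso SF SK U"
    and x: "x \<in> closure (ran_op SF)" and y: "y \<in> closure (ran_op SF)"
  shows "cinner (U x) (U y) = cinner x y"
proof -
  have c: "csubspace (closure (ran_op SF))" by (intro csubspace_closure csubspace_ran_op SF)
  have re: "U a \<bullet> U b = a \<bullet> b" if "a \<in> closure (ran_op SF)" "b \<in> closure (ran_op SF)" for a b
  proof -
    have "a + b \<in> closure (ran_op SF)" using c that by (simp add: csubspace_def)
    then have "(norm (U a + U b))\<^sup>2 = (norm (a + b))\<^sup>2" "(norm (U a))\<^sup>2 = (norm a)\<^sup>2" "(norm (U b))\<^sup>2 = (norm b)\<^sup>2"
      using U that unfolding is_part_iso_def clinear_fun_def by metis+
    then show ?thesis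
      by (simp add: power2_norm_eq_inner inner_add_left inner_add_right inner_commute)
  qed
  have "U (\<i> *\<^sub>C x) = \<i> *\<^sub>C U x" using U by (simp add: is_part_iso_def clinear_fun_def)
  then show ?thesis
    using re[OF x y] re[OF csubspace_scaleC[OF c x] y, of \<i>] by (simp add: complex_eq_iff Re_cinner Im_cinner)
qed

text \<open>Preimages of \<open>x\<close> differ by kernel vectors, and exactly one of them lies in
  the closed range; removing the kernel component of any preimage produces it.\<close>

lemma inv_sqrt_app:
  fixes T :: "'a::chilbert_space op"
  assumes S: "nonneg_selfadjoint (op_sqrt T)" and x: "x \<in> ran_op (op_sqrt T)"
  shows "(app (inv_sqrt T) x, x) \<in> op_sqrt T" "app (inv_sqrt T) x \<in> closure (ran_op (op_sqrt T))"
proof -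
  let ?S = "op_sqrt T"
  note op = nonneg_selfadjointD(1)[OF S]
  obtain f where f: "(f, x) \<in> ?S" using x by (auto simp: ran_op_def)
  obtain p k where p: "p \<in> closure (ran_op ?S)" "k \<in> ker_op ?S" "f = p + k"
    using ran_ker_decompose[OF S] by blast
  have px: "(p, x) \<in> ?S"
    using subspace_diff[OF is_operator_subspace[OF op] f, of "(k, 0)"] p by (simp add: ker_op_def)
  have inv: "(y, g) \<in> inv_sqrt T \<longleftrightarrow> (g, y) \<in> ?S \<and> g \<in> closure (ran_op ?S)" for y g
    unfolding inv_sqrt_def using app_eq[OF op] app_mem[OF op] by (force simp: dom_op_def)
  have "g = p" if g: "(x, g) \<in> inv_sqrt T" for g
  proof -
    have "(g - p, x - x) \<in> ?S"
      using subspace_diff[OF is_operator_subspace[OF op], of "(g, x)" "(p, x)"] g px inv by simp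
    then have "g - p \<in> ker_op ?S" by (simp add: ker_op_def)
    moreover have "g - p \<in> closure (ran_op ?S)"
      using g p(1) inv csubspace_closure[OF csubspace_ran_op[OF op]]
      by (simp add: csubspace_imp_subspace subspace_diff)
    ultimately have "g - p = 0" using ran_ker_orthogonal[OF S] inner_eq_zero_iff by blast
    then show ?thesis by simp
  qed
  moreover have "(x, p) \<in> inv_sqrt T" using inv px p(1) by blast
  ultimately have "app (inv_sqrt T) x = p" unfolding app_def by blast
  then show "(app (inv_sqrt T) x, x) \<in> ?S" "app (inv_sqrt T) x \<in> closure (ran_op ?S)"
    using px p(1) by simp_all
qed

lemma closed_radj: "closed (radj G)"
proof -
  have "radj G = (\<Inter>(x, w)\<in>G. {p. w \<bullet> fst p = x \<bullet> snd p})" by (auto simp: radj_def)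
  then show ?thesis by (auto intro!: closed_INT closed_Collect_eq continuous_intros)
qed

lemma op_sqrt_energy:
  fixes T :: "'a::chilbert_space op"
  assumes T: "nonneg_selfadjoint T" and uw: "(u, w) \<in> T"
  obtains s where "(u, s) \<in> op_sqrt T" "(s, w) \<in> op_sqrt T" "(norm s)\<^sup>2 = u \<bullet> w"
proof -
  have "(u, w) \<in> comp_op (op_sqrt T) (op_sqrt T)" using uw op_sqrt_works(2)[OF T] by simp
  then obtain s where s: "(u, s) \<in> op_sqrt T" "(s, w) \<in> op_sqrt T"
    by (auto simp: comp_op_def)
  then have "s \<bullet> s = u \<bullet> w"
    using nonneg_selfadjointD(3)[OF op_sqrt_works(1)[OF T]] radjD[of s w "op_sqrt T" u s]
    by (simp add: nonneg_sa_def)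
  then show thesis using that[OF s] by (simp add: power2_norm_eq_inner)
qed

lemma op_sqrt_norm:
  fixes T :: "'a::chilbert_space op"
  assumes T: "nonneg_selfadjoint T" and uw: "(u, w) \<in> T" and us: "(u, s) \<in> op_sqrt T"
  shows "(norm s)\<^sup>2 = u \<bullet> w"
proof -
  obtain s' where s': "(u, s') \<in> op_sqrt T" "(norm s')\<^sup>2 = u \<bullet> w" using op_sqrt_energy[OF T uw] by blast
  have "s' = s" by (rule is_operator_unique[OF nonneg_selfadjointD(1)[OF op_sqrt_works(1)[OF T]] s'(1) us])
  with s'(2) show ?thesis by simp
qed

section \<open>Comparison of the square roots of the two extensions\<close>

context nonneg_symmetric
begin

text \<open>On the domain of \<open>V\<close> both roots have squared norm equal to the form of
  \<open>V\<close>. That domain is a core for the Friedrichs root, and closedness of the Krein root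
  carries the equality to the limit.\<close>

lemma sqrt_isometry:
  assumes hs: "(h, s) \<in> op_sqrt (fried V)"
  shows "\<exists>t. (h, t) \<in> op_sqrt K \<and> norm t = norm s"
proof -
  let ?SF = "op_sqrt (fried V)" and ?SK = "op_sqrt K"
  have saF: "nonneg_selfadjoint ?SF" and saK: "nonneg_selfadjoint ?SK"
    by (intro op_sqrt_works friedrichs_selfadjoint K_selfadjoint)+
  note subF = is_operator_subspace[OF nonneg_selfadjointD(1)[OF saF]]
    and subK = is_operator_subspace[OF nonneg_selfadjointD(1)[OF saK]]
  note subV = is_operator_subspace[OF op]
  obtain C E where p: "sqrt_pair (fried V) C E"
    using nonneg_sa_sqrt_pair nonneg_selfadjointD(3)[OF friedrichs_selfadjoint] by blast
  interpret F: sqrt_pair "fried V" C E by (rule p)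
  have SF: "?SF = F.S" by (rule sqrt_pair_op_sqrt(1)[OF friedrichs_selfadjoint p])
  obtain x where x: "h = C x" "s = E x" using hs SF by (auto simp: F.S_def)
  have "dom_op F.S = range C" by (force simp: F.S_def dom_op_def)
  \<comment> \<open>The domain of the Friedrichs root is \<open>range C\<close>; its density
    upgrades \<open>fried_core\<close> from vectors in this range to the arbitrary parameter
    \<open>x\<close>.\<close>
  then have "closure (range C) = UNIV" using nonneg_selfadjointD(2)[OF saF] SF by simp
  moreover have "range C \<subseteq> closure ((\<lambda>(u, w). C (u + w)) ` V)" using F.fried_core[OF sym] by blast
  ultimately have "x \<in> closure ((\<lambda>(u, w). C (u + w)) ` V)" using closure_minimal by blast
  then obtain y where y: "\<And>n. y n \<in> (\<lambda>(u, w). C (u + w)) ` V" "y \<longlonglongrightarrow> x"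
    unfolding closure_sequential by blast
  have "\<exists>u w. (u, w) \<in> V \<and> y n = C (u + w)" for n using y(1)[of n] by auto
  then obtain u w where uw: "\<And>n. (u n, w n) \<in> V" "\<And>n. y n = C (u n + w n)" by metis
  have "(u n, w n) \<in> fried V" for n using fried_extends[OF sym] uw(1) by blast
  then have u: "u n = C (y n)" for n using F.T_resolvent uw(2) by metis
  have EF: "(u n, E (y n)) \<in> ?SF" for n unfolding SF u by (rule F.memS)
  have "\<exists>t. (u n, t) \<in> ?SK" for n
    using op_sqrt_energy[OF K_selfadjoint] K_extends uw(1)[of n] by (metis subsetD)
  then obtain t where t: "\<And>n. (u n, t n) \<in> ?SK" by metis
  have energy: "norm b = norm c" if "(f, g) \<in> V" "(f, b) \<in> ?SF" "(f, c) \<in> ?SK" for f g b c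
  proof -
    have "(f, g) \<in> fried V" "(f, g) \<in> K" using fried_extends[OF sym] K_extends that(1) by auto
    then have "(norm b)\<^sup>2 = (norm c)\<^sup>2"
      using op_sqrt_norm[OF friedrichs_selfadjoint _ that(2)] op_sqrt_norm[OF K_selfadjoint _ that(3)] by metis
    then show ?thesis by (simp add: power2_eq_iff_nonneg)
  qed
  have d: "norm (E (y m) - E (y n)) = norm (t m - t n)" for m n
    using energy[of "u m - u n" "w m - w n"] subspace_diff[OF subV uw(1)[of m] uw(1)[of n]]
      subspace_diff[OF subF EF[of m] EF[of n]] subspace_diff[OF subK t[of m] t[of n]] by simp
  have Ey: "(\<lambda>n. E (y n)) \<longlonglongrightarrow> s" unfolding x by (intro blinfun.tendsto tendsto_const y(2))
  then have "Cauchy (\<lambda>n. E (y n))" by (rule LIMSEQ_imp_Cauchy)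
  then have "Cauchy t" unfolding Cauchy_iff d .
  then obtain z where z: "t \<longlonglongrightarrow> z" using Cauchy_convergent convergent_def by blast
  have "u \<longlonglongrightarrow> h" unfolding x u by (intro blinfun.tendsto tendsto_const y(2))
  then have "(\<lambda>n. (u n, t n)) \<longlonglongrightarrow> (h, z)" using z by (rule tendsto_Pair)
  moreover have "closed ?SK"
    using closed_radj nonneg_selfadjointD(3)[OF saK] by (metis nonneg_sa_def)
  ultimately have "(h, z) \<in> ?SK"
    using closed_sequentially[of ?SK "\<lambda>n. (u n, t n)" "(h, z)"] t by blast
  moreover have "norm (E (y n)) = norm (t n)" for n by (rule energy[OF uw(1) EF t])
  then have "norm z = norm s" using tendsto_norm[OF z] tendsto_norm[OF Ey] LIMSEQ_unique by simp
  ultimately show ?thesis by blast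
qed

lemma K_sqrt_range:
  "closure (ran_op (op_sqrt K)) \<subseteq> closure {s. \<exists>u w. (u, w) \<in> V \<and> (u, s) \<in> op_sqrt K}"
proof -
  obtain C E where p: "sqrt_pair K C E" by (rule krein_pair)
  interpret K: sqrt_pair K C E by (rule p)
  note S = sqrt_pair_op_sqrt[OF K_selfadjoint p]
  have "dom_op K.S = range C" "ran_op K.S = range E" by (force simp: K.S_def dom_op_def ran_op_def)+
  then have "ran_op K.S \<subseteq> closure {s. \<exists>u w. (u, w) \<in> V \<and> (u, s) \<in> K.S}"
    using K.krein_range[OF sym K_def] nonneg_selfadjointD(2)[OF S(2)] by auto
  then show ?thesis unfolding S(1) by (simp add: closure_minimal)
qed

end

section \<open>Dual pairs with a common core\<close>

lemma selfadjoint_cinner: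
  assumes S: "nonneg_selfadjoint S" and "(x, s) \<in> S" "(y, t) \<in> S"
  shows "cinner s y = cinner x t"
proof -
  have "(y, t) \<in> adjoint S" using assms by (simp add: nonneg_selfadjoint_def selfadjoint_def)
  then show ?thesis using assms(2) by (auto simp: adjoint_def)
qed

locale core_dual_pair =
  fixes A At :: "'a::chilbert_space op" and D :: "'a set"
  assumes dual: "dual_pair A At"
    and D_sub: "D \<subseteq> dom_op A \<inter> dom_op At"
    and coreA: "is_core D A"
    and diss: "dissipative A"
begin

lemma opA: "is_operator A" and opAt: "is_operator At" and denseAt: "closure (dom_op At) = UNIV"
  using dual by (auto simp: dual_pair_def densely_defined_def)

lemma memA: "f \<in> D \<Longrightarrow> (f, app A f) \<in> A" and memAt: "f \<in> D \<Longrightarrow> (f, app At f) \<in> At"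
  using app_mem[OF opA] app_mem[OF opAt] D_sub by auto

lemma csubD: "csubspace D"
  using coreA by (simp add: is_core_def)

lemma A_At: "f \<in> D \<Longrightarrow> g \<in> D \<Longrightarrow> cinner (app At f) g = cinner f (app A g)"
  using dual memA[of g] memAt[of f] by (fastforce simp: dual_pair_def adjoint_def)

lemma At_A: "f \<in> D \<Longrightarrow> g \<in> D \<Longrightarrow> cinner (app A f) g = cinner f (app At g)"
  by (metis A_At cinner_commute)

abbreviation "V \<equiv> imag_part A At D"

lemma V_iff: "(f, g) \<in> V \<longleftrightarrow> f \<in> D \<and> g = (1 / (2 * \<i>)) *\<^sub>C (app A f - app At f)"
  by (auto simp: imag_part_def)

lemma V_diff: "(f, g) \<in> V \<Longrightarrow> app At f - app A f = (- 2 * \<i>) *\<^sub>C g"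
  by (simp add: V_iff scaleC_scaleC scaleC_one[of "app At f"] flip: scaleC_minus_right)

text \<open>On \<open>D\<close> the dual pair relation makes \<open>cinner f (app At f)\<close> the
  conjugate of \<open>cinner f (app A f)\<close>.\<close>

lemma V_form: "(f, g) \<in> V \<Longrightarrow> f \<bullet> g = Im (cinner f (app A f))"
proof -
  assume *: "(f, g) \<in> V"
  then have f: "f \<in> D" by (simp add: V_iff)
  have "cinner f (app At f) = cnj (cinner f (app A f))" using At_A[OF f f] cinner_commute by metis
  then show ?thesis using *
    by (simp add: V_iff cinner_scaleC_right cinner_diff_right flip: Re_cinner)
qed

text \<open>First components of the graph closure lie in the closure of \<open>D\<close>, so the
  core property passes density from \<open>dom_op A\<close> to \<open>D\<close>.\<close>

lemma dense_D: "closure D = UNIV"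
proof -
  have "x \<in> closure D" if x: "x \<in> dom_op A" for x
  proof -
    have "(x, app A x) \<in> closure (restrict_op A D)"
      using app_mem[OF opA x] coreA closure_subset by (auto simp: is_core_def)
    moreover have "closure (restrict_op A D) \<subseteq> closure (D \<times> UNIV)"
      by (rule closure_mono) (auto simp: restrict_op_def)
    ultimately show ?thesis by (auto simp: closure_Times)
  qed
  then have "closure (dom_op A) \<subseteq> closure D" by (intro closure_minimal) auto
  then show ?thesis using dual by (auto simp: dual_pair_def densely_defined_def)
qed

lemma app_linear:
  assumes "f \<in> D" "g \<in> D"
  shows "app A (f + g) = app A f + app A g" "app At (f + g) = app At f + app At g"
    "app A (c *\<^sub>C f) = c *\<^sub>C app A f" "app At (c *\<^sub>C f) = c *\<^sub>C app At f"
  by (intro app_eq opA opAt is_operator_add is_operator_scaleC memA memAt assms)+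

sublocale nonneg_symmetric V
proof
  have D: "0 \<in> D" "\<And>f g. f \<in> D \<Longrightarrow> g \<in> D \<Longrightarrow> f + g \<in> D" "\<And>c f. f \<in> D \<Longrightarrow> c *\<^sub>C f \<in> D"
    using csubD by (auto simp: csubspace_def)
  have zero: "app A 0 = 0" "app At 0 = 0" using app_eq opA opAt is_operator_zero by blast+
  show op: "is_operator V"
    unfolding is_operator_def V_iff using D
    by (auto simp: app_linear zero scaleC_add_right scaleC_diff_right scaleC_scaleC mult.commute)
  have "cinner w y = cinner x z" if "(x, w) \<in> V" "(y, z) \<in> V" for x w y z
    using that A_At At_A
    by (simp add: V_iff cinner_scaleC_left cinner_scaleC_right cinner_diff_left cinner_diff_right field_simps)
  then have "V \<subseteq> radj V" by (auto intro!: radjI simp flip: Re_cinner)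
  moreover have "0 \<le> x \<bullet> y" if xy: "(x, y) \<in> V" for x y
  proof -
    have "x \<in> D" using xy by (simp add: V_iff)
    then show ?thesis unfolding V_form[OF xy] using diss memA by (fastforce simp: dissipative_def)
  qed
  ultimately show "nonneg_sym V" using is_operator_subspace[OF op] by (auto simp: nonneg_sym_def)
  have "f \<in> dom_op V \<longleftrightarrow> f \<in> D" for f unfolding dom_op_def image_iff by (simp add: Bex_def split_paired_Ex V_iff)
  then have "dom_op V = D" by blast
  then show "closure (dom_op V) = UNIV" using dense_D by simp
qed

section \<open>Completing the square\<close>

abbreviation "SF \<equiv> op_sqrt (friedrichs V)"
abbreviation "SK \<equiv> op_sqrt (krein V)"
abbreviation "U \<equiv> part_iso (friedrichs V) (krein V)"

lemma saF: "nonneg_selfadjoint SF" and saK: "nonneg_selfadjoint SK"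
  unfolding friedrichs_eq krein_eq by (intro op_sqrt_works friedrichs_selfadjoint K_selfadjoint)+

lemma U: "is_part_iso SF SK U"
  by (rule part_iso_works[OF saF nonneg_selfadjointD(1)[OF saK]])
    (unfold friedrichs_eq krein_eq, rule sqrt_isometry)

text \<open>Here \<open>a = At\<^sup>* v\<close>, \<open>b = V\<^sub>K\<^sup>1\<^sup>/\<^sup>2 v\<close>, \<open>w = V\<^sub>F\<^sup>-\<^sup>1\<^sup>/\<^sup>2 l\<close> and
  \<open>\<xi> = V\<^sub>K\<^sup>1\<^sup>/\<^sup>2 f\<close>.\<close>

lemma complete_square:
  assumes fg: "(f, g) \<in> V" and f\<xi>: "(f, \<xi>) \<in> SK" and va: "(v, a) \<in> adjoint At"
    and vb: "(v, b) \<in> SK" and wl: "(w, l) \<in> SF" and w: "w \<in> closure (ran_op SF)"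
  shows "Im (cinner (f + v) (app A f + a + l)) =
    (norm (\<xi> - (\<i> / 2) *\<^sub>C (U w + (2 * \<i>) *\<^sub>C b)))\<^sup>2
      + (Im (cinner v (a + l)) - 1/4 * (norm (U w + (2 * \<i>) *\<^sub>C b))\<^sup>2)"
proof -
  let ?\<eta> = "U w + (2 * \<i>) *\<^sub>C b"
  have f: "f \<in> D" using fg by (simp add: V_iff)
  have K: "(f, g) \<in> krein V" and F: "(f, g) \<in> friedrichs V"
    using fg K_extends fried_extends[OF sym] unfolding krein_eq friedrichs_eq by auto
  have "(norm \<xi>)\<^sup>2 = f \<bullet> g"
    using op_sqrt_norm[OF _ K f\<xi>] K_selfadjoint unfolding krein_eq .
  then have 1: "Im (cinner f (app A f)) = (norm \<xi>)\<^sup>2" using V_form[OF fg] by simp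
  obtain \<xi>' where \<xi>': "(f, \<xi>') \<in> SK" "(\<xi>', g) \<in> SK"
    using op_sqrt_energy[OF _ K] K_selfadjoint unfolding krein_eq by metis
  have "\<xi>' = \<xi>" by (rule is_operator_unique[OF nonneg_selfadjointD(1)[OF saK] \<xi>'(1) f\<xi>])
  then have gv: "cinner g v = cinner \<xi> b" using selfadjoint_cinner[OF saK \<xi>'(2) vb] by simp
  have "cinner (app At f) v = cinner f a" using va memAt[OF f] by (auto simp: adjoint_def)
  moreover have "Im (cinner v (app A f)) = - Im (cinner (app A f) v)"
    by (subst cinner_commute) simp
  \<comment> \<open>Moving \<open>At\<close> onto \<open>f\<close> combines the two cross terms into
    the form of \<open>At - A\<close> at \<open>f\<close>, that is \<open>- 2 * \<i>\<close> times
    \<open>g\<close>; splitting \<open>V\<close> by the Krein root yields the \<open>b\<close>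
    term.\<close>
  ultimately have "Im (cinner f a) + Im (cinner v (app A f)) = Im (cinner (app At f - app A f) v)"
    by (simp add: cinner_diff_left)
  also have "\<dots> = Im (cinner \<xi> ((2 * \<i>) *\<^sub>C b))"
    unfolding V_diff[OF fg] by (simp add: cinner_scaleC_left cinner_scaleC_right gv)
  finally have 2: "Im (cinner f a) + Im (cinner v (app A f)) = Im (cinner \<xi> ((2 * \<i>) *\<^sub>C b))" .
  obtain s where s: "(f, s) \<in> SF"
    using op_sqrt_energy[OF _ F] friedrichs_selfadjoint unfolding friedrichs_eq by metis
  have "s \<in> closure (ran_op SF)" using s closure_subset by (force simp: mem_ran_op)
  moreover have "f \<in> dom_op SF" using s by (force simp: dom_op_def)
  then have "U s = \<xi>"
    using U app_eq[OF nonneg_selfadjointD(1)[OF saF] s] app_eq[OF nonneg_selfadjointD(1)[OF saK] f\<xi>]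
    by (simp add: is_part_iso_def)
  ultimately have "cinner s w = cinner \<xi> (U w)"
    using is_part_iso_cinner[OF nonneg_selfadjointD(1)[OF saF] U _ w] by metis
  \<comment> \<open>The Friedrichs root moves from \<open>l\<close> onto \<open>f\<close>; both
    resulting vectors lie in its closed range, where \<open>U\<close> preserves the inner product
    and maps the root at \<open>f\<close> to \<open>\<xi>\<close>.\<close>
  then have 3: "cinner f l = cinner \<xi> (U w)" using selfadjoint_cinner[OF saF s wl] by simp
  have "(norm (\<xi> - (\<i> / 2) *\<^sub>C ?\<eta>))\<^sup>2 =
      (norm \<xi>)\<^sup>2 - 2 * (\<xi> \<bullet> ((\<i> / 2) *\<^sub>C ?\<eta>)) + (norm ((\<i> / 2) *\<^sub>C ?\<eta>))\<^sup>2"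
    by (simp add: power2_norm_eq_inner inner_diff_left inner_diff_right inner_commute)
  also have "(norm ((\<i> / 2) *\<^sub>C ?\<eta>))\<^sup>2 = 1/4 * (norm ?\<eta>)\<^sup>2"
    by (simp add: norm_scaleC power_divide norm_divide)
  also have "2 * (\<xi> \<bullet> ((\<i> / 2) *\<^sub>C ?\<eta>)) = - Im (cinner \<xi> ?\<eta>)"
    unfolding Re_cinner[symmetric] cinner_scaleC_right by simp
  finally have "(norm (\<xi> - (\<i> / 2) *\<^sub>C ?\<eta>))\<^sup>2 = (norm \<xi>)\<^sup>2 + Im (cinner \<xi> ?\<eta>) + 1/4 * (norm ?\<eta>)\<^sup>2"
    by simp
  moreover have "Im (cinner (f + v) (app A f + a + l)) =
      Im (cinner f (app A f)) + (Im (cinner f a) + Im (cinner v (app A f))) + Im (cinner f l)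
        + Im (cinner v (a + l))"
    by (simp add: cinner_add_left cinner_add_right)
  ultimately show ?thesis unfolding 1 2 3 by (simp add: cinner_add_right)
qed

end

section \<open>The dissipativity criterion\<close>

theorem theorem4p4:
  fixes A At :: "'h::chilbert_space op"
    and D W :: "'h set"
    and L :: "'h \<Rightarrow> 'h"
  assumes dual: "dual_pair A At"
    and closedA: "closed_op A" and closedAt: "closed_op At"
    and D_sub: "D \<subseteq> dom_op A \<inter> dom_op At"
    and coreA: "is_core D A" and coreAt: "is_core D At"
    and diss: "dissipative A"
    and W_sub: "csubspace W" "W \<subseteq> dom_op (adjoint At)"
    and W_int: "W \<inter> dom_op A = {0}"
    and L_lin: "\<forall>v\<in>W. \<forall>w\<in>W. L (v + w) = L v + L w"
               "\<forall>c. \<forall>v\<in>W. L (c *\<^sub>C v) = c *\<^sub>C L v"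
    and VK_dom: "\<forall>v\<in>W. v \<in> dom_op (op_sqrt (krein (imag_part A At D)))"
    and VF_ran: "\<forall>v\<in>W. L v \<in> ran_op (op_sqrt (friedrichs (imag_part A At D)))"
  shows "dissipative (ext_op A At W L) \<longleftrightarrow>
    (\<forall>v\<in>W. Im (cinner v (app (adjoint At) v + L v)) \<ge>
       1/4 * (norm (part_iso (friedrichs (imag_part A At D)) (krein (imag_part A At D))
                 (app (inv_sqrt (friedrichs (imag_part A At D))) (L v))
               + (2 * \<i>) *\<^sub>C app (op_sqrt (krein (imag_part A At D))) v))\<^sup>2)"
proof -
  interpret core_dual_pair A At D using dual D_sub coreA diss by unfold_locales
  let ?V = "imag_part A At D"
  let ?SF = "op_sqrt (friedrichs ?V)" and ?SK = "op_sqrt (krein ?V)"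
  let ?U = "part_iso (friedrichs ?V) (krein ?V)"
  let ?At = "adjoint At"
  define \<eta> where "\<eta> v = ?U (app (inv_sqrt (friedrichs ?V)) (L v)) + (2 * \<i>) *\<^sub>C app ?SK v" for v
  \<comment> \<open>The difference of the two sides of the claimed inequality, which is also the
    remainder left after completing the square.\<close>
  define q where "q v = Im (cinner v (app ?At v + L v)) - 1/4 * (norm (\<eta> v))\<^sup>2" for v
  have adjAt: "?At = radj At" by (rule adjoint_eq_radj[OF is_operator_i_inv[OF opAt]])
  have opAdj: "is_operator ?At" unfolding adjAt
    by (intro is_operatorI subspace_radj i_inv_radj is_operator_i_inv[OF opAt])
      (rule radj_single_valued[OF denseAt])
  have A_adj: "A \<subseteq> ?At" using dual by (simp add: dual_pair_def)
  have app_sum: "app ?At (f + v) = a + app ?At v" if "(f, a) \<in> A" "v \<in> W" for f a v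
    using that A_adj W_sub(2) by (intro app_eq[OF opAdj] is_operator_add[OF opAdj] app_mem[OF opAdj]) auto
  have square: "Im (cinner (f + v) (app A f + app ?At v + L v)) = (norm (\<xi> - (\<i> / 2) *\<^sub>C \<eta> v))\<^sup>2 + q v"
    if "(f, g) \<in> ?V" "(f, \<xi>) \<in> ?SK" "v \<in> W" for f g \<xi> v
    unfolding \<eta>_def q_def
  proof (rule complete_square[OF that(1,2)])
    show "(v, app ?At v) \<in> ?At" using app_mem[OF opAdj] W_sub(2) that(3) by blast
    show "(v, app ?SK v) \<in> ?SK" using app_mem[OF nonneg_selfadjointD(1)[OF saK]] VK_dom that(3) by blast
    show "(app (inv_sqrt (friedrichs ?V)) (L v), L v) \<in> ?SF"
      "app (inv_sqrt (friedrichs ?V)) (L v) \<in> closure (ran_op ?SF)"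
      using inv_sqrt_app[OF saF] VF_ran that(3) by blast+
  qed
  have "dissipative (ext_op A At W L) \<longleftrightarrow> (\<forall>v\<in>W. 0 \<le> q v)"
  proof
    assume d: "dissipative (ext_op A At W L)"
    show "\<forall>v\<in>W. 0 \<le> q v"
    proof
      fix v assume v: "v \<in> W"
      have ge: "0 \<le> (norm (\<xi> - (\<i> / 2) *\<^sub>C \<eta> v))\<^sup>2 + q v" if "(f, g) \<in> ?V" "(f, \<xi>) \<in> ?SK" for f g \<xi>
      proof -
        have f: "f \<in> D" using that(1) by (simp add: V_iff)
        then have "f \<in> dom_op A" using D_sub by blast
        then have "(f + v, app ?At (f + v) + L v) \<in> ext_op A At W L" using v by (auto simp: ext_op_def)
        then have "0 \<le> Im (cinner (f + v) (app ?At (f + v) + L v))" using d by (auto simp: dissipative_def)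
        then show ?thesis using square[OF that v] app_sum[OF memA[OF f] v] by simp
      qed
      let ?R = "closure (ran_op ?SK)"
      have cR: "csubspace ?R" by (intro csubspace_closure csubspace_ran_op nonneg_selfadjointD(1)[OF saK])
      have "app ?SK v \<in> ran_op ?SK"
        using app_mem[OF nonneg_selfadjointD(1)[OF saK]] VK_dom v by (auto simp: mem_ran_op)
      then have "app ?SK v \<in> ?R" using closure_subset by blast
      moreover have "?U x \<in> ?R" for x using U by (auto simp: is_part_iso_def)
      \<comment> \<open>The centre of the square lies in the closed range of the Krein root, so
        \<open>K_sqrt_range\<close> lets values of that root on the domain of \<open>V\<close>
        approach it and the square tends to 0.\<close>
      ultimately have "(\<i> / 2) *\<^sub>C \<eta> v \<in> ?R"
        unfolding \<eta>_def using cR by (simp add: csubspace_def)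
      then have "(\<i> / 2) *\<^sub>C \<eta> v \<in> closure {s. \<exists>u w. (u, w) \<in> ?V \<and> (u, s) \<in> ?SK}"
        using K_sqrt_range unfolding krein_eq by blast
      then obtain \<xi> where \<xi>: "\<And>n. \<exists>u w. (u, w) \<in> ?V \<and> (u, \<xi> n) \<in> ?SK" "\<xi> \<longlonglongrightarrow> (\<i> / 2) *\<^sub>C \<eta> v"
        unfolding closure_sequential by blast
      have "(\<lambda>n. (norm (\<xi> n - (\<i> / 2) *\<^sub>C \<eta> v))\<^sup>2 + q v) \<longlonglongrightarrow> (norm ((\<i> / 2) *\<^sub>C \<eta> v - (\<i> / 2) *\<^sub>C \<eta> v))\<^sup>2 + q v"
        by (intro tendsto_intros \<xi>(2))
      moreover have "0 \<le> (norm (\<xi> n - (\<i> / 2) *\<^sub>C \<eta> v))\<^sup>2 + q v" for n using \<xi>(1)[of n] ge by blast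
      ultimately have "0 \<le> (norm ((\<i> / 2) *\<^sub>C \<eta> v - (\<i> / 2) *\<^sub>C \<eta> v))\<^sup>2 + q v"
        by (intro LIMSEQ_le_const) auto
      then show "0 \<le> q v" by simp
    qed
  next
    assume q: "\<forall>v\<in>W. 0 \<le> q v"
    have "0 \<le> Im (cinner (f + v) (app ?At (f + v) + L v))" if f: "f \<in> dom_op A" and v: "v \<in> W" for f v
    proof -
      \<comment> \<open>With \<open>v\<close> fixed, nonnegativity is a closed condition on the pair
        \<open>(f, app A f)\<close>; verified over \<open>D\<close>, it extends to the whole graph
        of \<open>A\<close> by the core property.\<close>
      let ?C = "{p. 0 \<le> (\<i> *\<^sub>C (fst p + v)) \<bullet> (snd p + app ?At v + L v)}"
      have "closed ?C"
        by (intro closed_Collect_le continuous_intros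
            continuous_on_compose2[OF linear_continuous_on[OF bounded_linear_scaleC, of UNIV]]) auto
      moreover have "restrict_op A D \<subseteq> ?C"
      proof clarify
        fix x y assume "(x, y) \<in> restrict_op A D"
        then have x: "x \<in> D" "y = app A x" using app_eq[OF opA] by (auto simp: restrict_op_def)
        then obtain g where g: "(x, g) \<in> ?V" by (auto simp: V_iff)
        then have K: "(x, g) \<in> krein ?V" using K_extends krein_eq by auto
        obtain \<xi> where "(x, \<xi>) \<in> ?SK"
          using op_sqrt_energy[OF _ K] K_selfadjoint unfolding krein_eq by metis
        from square[OF g this v] have "0 \<le> Im (cinner (x + v) (app A x + app ?At v + L v))"
          using q v by simp
        then show "0 \<le> (\<i> *\<^sub>C (fst (x, y) + v)) \<bullet> (snd (x, y) + app ?At v + L v)"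
          by (simp add: x(2) Im_cinner)
      qed
      ultimately have "closure (restrict_op A D) \<subseteq> ?C" by (intro closure_minimal)
      moreover have fA: "(f, app A f) \<in> A" by (rule app_mem[OF opA f])
      then have "(f, app A f) \<in> closure (restrict_op A D)"
        using coreA closure_subset[of A] by (auto simp: is_core_def)
      ultimately show ?thesis unfolding app_sum[OF fA v] by (auto simp: Im_cinner)
    qed
    then show "dissipative (ext_op A At W L)" by (auto simp: dissipative_def ext_op_def)
  qed
  then show ?thesis by (simp add: q_def \<eta>_def)
qed

end
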